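(* Let $k\ge2$, $m\ge3$ and $0<\alpha<1$. Among all $k$-uniform linear unicyclic hypergraphs with $m$ hyperedges, the last hypergraph in $S_\alpha$-order is $C_3^{(k)}\odot S_{m-3}^{(k)}$.
   Context: Hypergraphs are finite; $k$-uniform means every hyperedge has exactly $k$ vertices; linear means any two distinct hyperedges share at most one vertex; unicyclic means connected with exactly one cycle. A cored vertex is a vertex of degree one. "Adding a pendant hyperedge to a vertex $v$" means adding a new hyperedge consisting of $v$ and $k-1$ new vertices. The hypercycle $C_g^{(k)}$ is obtained from the cycle graph $C_g$ by inserting $k-2$ new (cored) vertices into each edge. $C_3^{(k)}\odot S_{m-3}^{(k)}$ is obtained from $C_3^{(k)}$ by adding $m-3$ pendant hyperedges to one non-cored vertex of $C_3^{(k)}$. For a $k$-uniform hypergraph $\mathcal{H}$ on $[n]$, $\mathcal{A}(\mathcal{H})$ is the $k$-order $n$-dimensional tensor with entry $\frac1{(k-1)!}$ at $(i_1,\dots,i_k)$ if $\{i_1,\dots,i_k\}\in E(\mathcal{H})$ and $0$ otherwise; $\mathcal{D}(\mathcal{H})$ is the diagonal tensor of vertex degrees; $\mathcal{A}_\alpha(\mathcal{H})=\alpha\mathcal{D}(\mathcal{H})+(1-\alpha)\mathcal{A}(\mathcal{H})$. For a tensor $\mathcal{T}$, $\mathrm{Tr}_d(\mathcal{T})$ is the sum of the $d$-th powers of all $n(k-1)^{n-1}$ eigenvalues of $\mathcal{T}$ (roots of its characteristic polynomial, with multiplicity); in particular $\mathrm{Tr}_0(\mathcal{T})=n(k-1)^{n-1}$,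 and for $d\ge1$ $$\mathrm{Tr}_{d}(\mathcal{T})=(k-1)^{n-1}\sum_{d_1+\cdots+d_n=d}\ \prod_{i=1}^{n}\frac{1}{(d_i(k-1))!}\Big(\sum_{\gamma\in[n]^{k-1}}(\mathcal{T})_{i\gamma}\frac{\partial}{\partial a_{i\gamma}}\Big)^{d_i}\mathrm{tr}\big(A^{d(k-1)}\big),$$ with $A=(a_{ij})$ an $n\times n$ matrix of indeterminates, $d_i\ge0$ integers, $\frac{\partial}{\partial a_{i\gamma}}=\frac{\partial}{\partial a_{i i_2}}\cdots\frac{\partial}{\partial a_{i i_k}}$ for $\gamma=i_2\cdots i_k$. $S_\alpha$-order: for $k$-uniform hypergraphs $\mathcal{H}_1,\mathcal{H}_2$ with $n$ vertices, $\mathcal{H}_1\prec_\alpha\mathcal{H}_2$ if there is $d\in\{1,\dots,n(k-1)^{n-1}-1\}$ with $\mathrm{Tr}_t(\mathcal{A}_\alpha(\mathcal{H}_1))=\mathrm{Tr}_t(\mathcal{A}_\alpha(\mathcal{H}_2))$ for $t=0,\dots,d-1$ and $\mathrm{Tr}_d(\mathcal{A}_\alpha(\mathcal{H}_1))<\mathrm{Tr}_d(\mathcal{A}_\alpha(\mathcal{H}_2))$. "$X$ is the last hypergraph in a class" means $X$ is in the class and $\mathcal{H}\prec_\alpha X$ for every $\mathcal{H}$ in the class not isomorphic to $X$. *)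

theory Defs
  imports Complex_Main "HOL-Library.Poly_Mapping"
begin

section \<open>Hypergraphs\<close>

record 'a hypergraph =
  verts :: "'a set"
  edges :: "'a set set"

definition hypergraph :: "'a hypergraph \<Rightarrow> bool" where
  "hypergraph H \<longleftrightarrow> finite (verts H) \<and> (\<forall>e\<in>edges H. e \<subseteq> verts H)"

definition uniform :: "nat \<Rightarrow> 'a hypergraph \<Rightarrow> bool" where
  "uniform k H \<longleftrightarrow> (\<forall>e\<in>edges H. card e = k)"

definition linear_hg :: "'a hypergraph \<Rightarrow> bool" where
  "linear_hg H \<longleftrightarrow> (\<forall>e\<in>edges H. \<forall>f\<in>edges H. e \<noteq> f \<longrightarrow> card (e \<inter> f) \<le> 1)"

definition degree :: "'a hypergraph \<Rightarrow> 'a \<Rightarrow> nat" where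
  "degree H v = card {e \<in> edges H. v \<in> e}"

definition cored :: "'a hypergraph \<Rightarrow> 'a \<Rightarrow> bool" where
  "cored H v \<longleftrightarrow> v \<in> verts H \<and> degree H v = 1"

definition connected_hg :: "'a hypergraph \<Rightarrow> bool" where
  "connected_hg H \<longleftrightarrow>
     (\<forall>u\<in>verts H. \<forall>v\<in>verts H. (u, v) \<in> {(x, y). \<exists>e\<in>edges H. x \<in> e \<and> y \<in> e}\<^sup>*)"

text \<open>
  A cycle is an alternating closed sequence \<open>v\<^sub>0 e\<^sub>0 v\<^sub>1 e\<^sub>1 \<dots> v\<^sub>l\<^sub>-\<^sub>1 e\<^sub>l\<^sub>-\<^sub>1 v\<^sub>0\<close> (\<open>l \<ge> 2\<close>) of pairwise
  distinct vertices and pairwise distinct edges, consecutive members being incident.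
\<close>

definition cycle_seq :: "'a hypergraph \<Rightarrow> 'a list \<Rightarrow> 'a set list \<Rightarrow> bool" where
  "cycle_seq H vs es \<longleftrightarrow>
     length vs = length es \<and> 2 \<le> length vs \<and> distinct vs \<and> distinct es \<and>
     set vs \<subseteq> verts H \<and> set es \<subseteq> edges H \<and>
     (\<forall>i<length vs. vs ! i \<in> es ! i \<and> vs ! (Suc i mod length vs) \<in> es ! i)"

text \<open>
  Two such sequences are the same cycle, i.e. agree up to the choice of the starting point and of
  the direction, iff they traverse the same vertex-edge incidences.
\<close>

definition incidences :: "'a list \<Rightarrow> 'a set list \<Rightarrow> ('a \<times> 'a set) set" where
  "incidences vs es =
     (\<Union>i<length vs. {(vs ! i, es ! i), (vs ! (Suc i mod length vs), es ! i)})"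

definition cycles :: "'a hypergraph \<Rightarrow> ('a \<times> 'a set) set set" where
  "cycles H = {incidences vs es | vs es. cycle_seq H vs es}"

definition unicyclic :: "'a hypergraph \<Rightarrow> bool" where
  "unicyclic H \<longleftrightarrow> connected_hg H \<and> (\<exists>!C. C \<in> cycles H)"

definition linear_unicyclic :: "nat \<Rightarrow> nat \<Rightarrow> 'a hypergraph \<Rightarrow> bool" where
  "linear_unicyclic k m H \<longleftrightarrow>
     hypergraph H \<and> uniform k H \<and> linear_hg H \<and> unicyclic H \<and> card (edges H) = m"

definition isomorphic :: "'a hypergraph \<Rightarrow> 'b hypergraph \<Rightarrow> bool" where
  "isomorphic G H \<longleftrightarrow> (\<exists>f. bij_betw f (verts G) (verts H) \<and> (\<lambda>e. f ` e) ` edges G = edges H)"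

section \<open>Hypercycles and pendant hyperedges\<close>

definition cycle_graph :: "nat \<Rightarrow> nat hypergraph" where
  "cycle_graph g = \<lparr>verts = {..<g}, edges = (\<lambda>i. {i, Suc i mod g}) ` {..<g}\<rparr>"

text \<open>\<open>Inr (e, j)\<close>, for \<open>j < k - 2\<close>, are the new vertices inserted into the edge \<open>e\<close>.\<close>

definition insert_cored :: "nat \<Rightarrow> 'a hypergraph \<Rightarrow> ('a + 'a set \<times> nat) hypergraph" where
  "insert_cored k G =
     \<lparr>verts = Inl ` verts G \<union> Inr ` (edges G \<times> {..<k - 2}),
      edges = (\<lambda>e. Inl ` e \<union> Inr ` ({e} \<times> {..<k - 2})) ` edges G\<rparr>"

definition hypercycle :: "nat \<Rightarrow> nat \<Rightarrow> (nat + nat set \<times> nat) hypergraph" where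
  "hypercycle k g = insert_cored k (cycle_graph g)"

text \<open>
  \<open>s\<close> pendant hyperedges are added to \<open>v\<close>; \<open>Inr (i, j)\<close>, for \<open>j < k - 1\<close>, are the new vertices
  of the \<open>i\<close>-th one.
\<close>

definition add_pendants :: "nat \<Rightarrow> nat \<Rightarrow> 'a \<Rightarrow> 'a hypergraph \<Rightarrow> ('a + nat \<times> nat) hypergraph" where
  "add_pendants k s v H =
     \<lparr>verts = Inl ` verts H \<union> Inr ` ({..<s} \<times> {..<k - 1}),
      edges = (\<lambda>e. Inl ` e) ` edges H \<union>
              (\<lambda>i. insert (Inl v) (Inr ` ({i} \<times> {..<k - 1}))) ` {..<s}\<rparr>"

section \<open>Tensors of a hypergraph\<close>

text \<open>
  A tensor of order \<open>k\<close> with index set \<open>V\<close> is a function on lists, of which only the values at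
  lists of length \<open>k\<close> over \<open>V\<close> matter.  The index set is the vertex set itself instead of \<open>[n]\<close>.
\<close>

type_synonym 'a tensor = "'a list \<Rightarrow> real"

definition adjacency_tensor :: "nat \<Rightarrow> 'a hypergraph \<Rightarrow> 'a tensor" where
  "adjacency_tensor k H is = (if set is \<in> edges H then 1 / fact (k - 1) else 0)"

definition degree_tensor :: "nat \<Rightarrow> 'a hypergraph \<Rightarrow> 'a tensor" where
  "degree_tensor k H is = (if is = replicate k (hd is) then real (degree H (hd is)) else 0)"

definition A_alpha :: "nat \<Rightarrow> real \<Rightarrow> 'a hypergraph \<Rightarrow> 'a tensor" where
  "A_alpha k \<alpha> H is = \<alpha> * degree_tensor k H is + (1 - \<alpha>) * adjacency_tensor k H is"

section \<open>Traces of a tensor\<close>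

text \<open>
  Polynomials over \<open>\<real>\<close> in indeterminates \<open>'v\<close>: monomials are finitely supported exponent
  functions.
\<close>

type_synonym 'v mpoly = "('v \<Rightarrow>\<^sub>0 nat) \<Rightarrow>\<^sub>0 real"

definition const_poly :: "real \<Rightarrow> 'v mpoly" where
  "const_poly c = Poly_Mapping.single 0 c"

definition indet :: "'v \<Rightarrow> 'v mpoly" where
  "indet x = Poly_Mapping.single (Poly_Mapping.single x 1) 1"

definition partial :: "'v \<Rightarrow> 'v mpoly \<Rightarrow> 'v mpoly" where
  "partial x p = (\<Sum>m\<in>Poly_Mapping.keys p.
     Poly_Mapping.single (m - Poly_Mapping.single x 1)
       (Poly_Mapping.lookup p m * real (Poly_Mapping.lookup m x)))"

text \<open>Powers and trace of the \<open>V \<times> V\<close> matrix \<open>A\<close> whose \<open>(i, j)\<close> entry is the indeterminate \<open>(i, j)\<close>.\<close>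

primrec generic_power :: "'a set \<Rightarrow> nat \<Rightarrow> 'a \<Rightarrow> 'a \<Rightarrow> ('a \<times> 'a) mpoly" where
  "generic_power V 0 i j = (if i = j then 1 else 0)"
| "generic_power V (Suc r) i j = (\<Sum>l\<in>V. indet (i, l) * generic_power V r l j)"

definition trace_power :: "'a set \<Rightarrow> nat \<Rightarrow> ('a \<times> 'a) mpoly" where
  "trace_power V r = (\<Sum>i\<in>V. generic_power V r i i)"

text \<open>The operator \<open>\<Sum>\<^sub>\<gamma> T\<^sub>i\<^sub>\<gamma> \<partial>/\<partial>a\<^sub>i\<^sub>\<gamma>\<close>, where \<open>\<gamma>\<close> ranges over \<open>V\<^sup>k\<^sup>-\<^sup>1\<close>.\<close>

definition row_op ::
    "nat \<Rightarrow> 'a set \<Rightarrow> 'a tensor \<Rightarrow> 'a \<Rightarrow> ('a \<times> 'a) mpoly \<Rightarrow> ('a \<times> 'a) mpoly" where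
  "row_op k V T i p =
     (\<Sum>\<gamma> \<in> {\<gamma>. set \<gamma> \<subseteq> V \<and> length \<gamma> = k - 1}.
        const_poly (T (i # \<gamma>)) * foldr (\<lambda>j. partial (i, j)) \<gamma> p)"

text \<open>
  The composition over all \<open>i \<in> V\<close> of the powers \<open>(row_op k V T i)\<^sup>d\<^sup>i\<close>; these operators commute
  (see below), so the fold does not depend on the order of composition.
\<close>

definition total_op ::
    "nat \<Rightarrow> 'a set \<Rightarrow> 'a tensor \<Rightarrow> ('a \<Rightarrow> nat) \<Rightarrow> ('a \<times> 'a) mpoly \<Rightarrow> ('a \<times> 'a) mpoly" where
  "total_op k V T d p = Finite_Set.fold (\<lambda>i. row_op k V T i ^^ d i) p V"

text \<open>
  The trace \<open>Tr\<^sub>d(T)\<close>, in the form of the explicit formula for the sum of the \<open>d\<close>-th powers of the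
  \<open>n (k - 1)\<^sup>n\<^sup>-\<^sup>1\<close> eigenvalues of \<open>T\<close>.
  The \<open>d (k - 1)\<close> differentiations turn the form \<open>tr (A\<^sup>d\<^sup>(\<^sup>k\<^sup>-\<^sup>1\<^sup>))\<close> of degree \<open>d (k - 1)\<close>
  into a constant polynomial, and \<open>lookup _ 0\<close> reads off that constant.
\<close>

definition Tr :: "nat \<Rightarrow> 'a set \<Rightarrow> 'a tensor \<Rightarrow> nat \<Rightarrow> real" where
  "Tr k V T d =
     (if d = 0 then real (card V * (k - 1) ^ (card V - 1))
      else real ((k - 1) ^ (card V - 1)) *
        (\<Sum>\<delta> \<in> {\<delta>. (\<forall>i. i \<notin> V \<longrightarrow> \<delta> i = 0) \<and> (\<Sum>i\<in>V. \<delta> i) = d}.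
           (\<Prod>i\<in>V. 1 / fact (\<delta> i * (k - 1))) *
           Poly_Mapping.lookup (total_op k V T \<delta> (trace_power V (d * (k - 1)))) 0))"

section \<open>The order\<close>

definition S_less :: "nat \<Rightarrow> real \<Rightarrow> 'a hypergraph \<Rightarrow> 'b hypergraph \<Rightarrow> bool" where
  "S_less k \<alpha> G H \<longleftrightarrow>
     card (verts G) = card (verts H) \<and>
     (\<exists>d \<in> {1..card (verts G) * (k - 1) ^ (card (verts G) - 1) - 1}.
        (\<forall>t<d. Tr k (verts G) (A_alpha k \<alpha> G) t = Tr k (verts H) (A_alpha k \<alpha> H) t) \<and>
        Tr k (verts G) (A_alpha k \<alpha> G) d < Tr k (verts H) (A_alpha k \<alpha> H) d)"

section \<open>Commutation of the differential operators\<close>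

lemma lookup_partial:
  "Poly_Mapping.lookup (partial x p) m =
     real (Poly_Mapping.lookup m x + 1) * Poly_Mapping.lookup p (m + Poly_Mapping.single x 1)"
proof -
  let ?s = "Poly_Mapping.single x (1::nat)"
  let ?c = "\<lambda>a. Poly_Mapping.lookup p a * real (Poly_Mapping.lookup a x)"
  have eq: "(?c a when a - ?s = m) = (?c a when a = m + ?s)" for a
  proof (cases "Poly_Mapping.lookup a x = 0")
    case True
    then have "a \<noteq> m + ?s" by (auto simp: lookup_add)
    with True show ?thesis by simp
  next
    case False
    then have "a - ?s + ?s = a"
      by (intro poly_mapping_eqI) (auto simp: lookup_add lookup_minus lookup_single when_def)
    then have "a - ?s = m \<longleftrightarrow> a = m + ?s" by auto
    then show ?thesis by simp
  qed
  have "Poly_Mapping.lookup (partial x p) m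
      = (\<Sum>a\<in>Poly_Mapping.keys p. (?c a when a = m + ?s))"
    unfolding partial_def lookup_sum lookup_single eq ..
  also have "\<dots> = ?c (m + ?s)"
    by (auto simp: when_def sum.delta in_keys_iff)
  finally show ?thesis by (simp add: lookup_add algebra_simps)
qed

lemma partial_commute: "partial x (partial y p) = partial y (partial x p)"
  by (cases "x = y")
     (auto intro!: poly_mapping_eqI simp: lookup_partial lookup_add lookup_single add_ac)

lemma lookup_const_mult:
  "Poly_Mapping.lookup (const_poly c * p) m = c * Poly_Mapping.lookup p m"
proof -
  have "const_poly c * p = Poly_Mapping.map ((*) c) p"
    unfolding const_poly_def by (rule mult_map_scale_conv_mult[symmetric])
  then show ?thesis by (simp add: Poly_Mapping.map.rep_eq when_def)
qed

lemma partial_const_mult: "partial x (const_poly c * p) = const_poly c * partial x p"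
  by (rule poly_mapping_eqI) (simp only: lookup_partial lookup_const_mult mult.left_commute)

lemma partial_sum: "partial x (\<Sum>i\<in>I. f i) = (\<Sum>i\<in>I. partial x (f i))"
  by (rule poly_mapping_eqI) (simp add: lookup_partial lookup_sum sum_distrib_left)

lemma foldr_partial_sum:
  "foldr (\<lambda>j. partial (g j)) js (\<Sum>i\<in>I. f i) = (\<Sum>i\<in>I. foldr (\<lambda>j. partial (g j)) js (f i))"
  by (induction js) (simp_all add: partial_sum)

lemma foldr_partial_const_mult:
  "foldr (\<lambda>j. partial (g j)) js (const_poly c * p) =
     const_poly c * foldr (\<lambda>j. partial (g j)) js p"
  by (induction js) (simp_all add: partial_const_mult)

lemma partial_foldr_partial:
  "partial x (foldr (\<lambda>j. partial (g j)) js p) = foldr (\<lambda>j. partial (g j)) js (partial x p)"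
  by (induction js) (simp_all add: partial_commute[of x])

lemma foldr_partial_commute:
  "foldr (\<lambda>i. partial (f i)) is (foldr (\<lambda>j. partial (g j)) js p) =
     foldr (\<lambda>j. partial (g j)) js (foldr (\<lambda>i. partial (f i)) is p)"
  by (induction "is") (simp_all add: partial_foldr_partial)

lemma row_op_commute: "row_op k V T i (row_op k V T j p) = row_op k V T j (row_op k V T i p)"
  unfolding row_op_def foldr_partial_sum foldr_partial_const_mult sum_distrib_left
  by (subst sum.swap)
     (simp add: foldr_partial_commute[where f = "\<lambda>l. (i, l)" and g = "\<lambda>l. (j, l)"] mult.left_commute)

lemma row_op_comp_fun_commute: "comp_fun_commute (\<lambda>i. row_op k V T i ^^ d i)"
proof
  fix i j
  show "row_op k V T j ^^ d j \<circ> row_op k V T i ^^ d i =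
        row_op k V T i ^^ d i \<circ> row_op k V T j ^^ d j"
  proof -
    have one: "row_op k V T i ((row_op k V T j ^^ b) p) = (row_op k V T j ^^ b) (row_op k V T i p)"
      for b p by (induction b) (simp_all add: row_op_commute[of k V T i j])
    have "(row_op k V T i ^^ a) ((row_op k V T j ^^ b) p) =
          (row_op k V T j ^^ b) ((row_op k V T i ^^ a) p)" for a b p
      by (induction a) (simp_all add: one)
    then show ?thesis by (auto simp: fun_eq_iff)
  qed
qed

end

theory Submission
  imports Defs
begin

text \<open>
  The order is already decided by the second trace. Up to positive factors, the first trace is the
  sum of the degrees and the second one is \<open>\<alpha>\<^sup>2\<close> times the sum of their squares plus a term that
  depends only on \<open>k\<close> and \<open>m\<close>: a differential operator contributes only where its monomial is that of
  a closed walk, and off-diagonal entries of the tensor yield such a monomial only if \<open>k = 2\<close>.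

  A linear unicyclic hypergraph has \<open>m (k - 1)\<close> vertices, so that its surplus degrees \<open>degree - 1\<close>
  sum up to \<open>m\<close>, and at least three of them are positive because of the cycle. If all degrees are
  less than \<open>m - 1\<close>, then the sum of squares is less than for the degrees \<open>m - 1, 2, 2, 1, \<dots>, 1\<close>.
  A vertex of degree at least \<open>m - 1\<close>, on the other hand, leaves out exactly one edge, and counting
  vertices shows that this edge meets exactly two of the others, which determines the hypergraph.
\<close>

section \<open>Closed walks and the trace of a matrix power\<close>

text \<open>Taking derivatives of tr(A^r) and reading off the constant selects one coefficient of
  tr(A^r), namely at the product of the \<open>row_monom\<close>s of the lists used. Total weight at
  most two means that all arcs leave from at most two vertices. Since every vertex that is entered
  must be left again, a contributing walk sees no third vertex, while an adjacency entry spans k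
  distinct ones. Loops at two different vertices do not help either, because a walk cannot pass from
  one to the other. The obstacle on the combinatorial side is that uniqueness of the cycle says
  nothing directly about the number of vertices. That number comes from adding edges one at a time:
  two attachment vertices create a cycle, and three would create two different ones. Since the
  number of vertices and the sum of the degrees d are then fixed, d^2 may be replaced by (d - 1)(d -
  2), which is nonnegative and ignores degrees 1 and 2. One vertex of degree m - 1 contributes (m -
  2)(m - 3), more than the bound (m - 3)(m - 3) for all vertices together when degrees stay below m
  - 1.\<close>

definition row_monom :: "'a \<Rightarrow> 'a list \<Rightarrow> ('a \<times> 'a) \<Rightarrow>\<^sub>0 nat" where
  "row_monom i \<gamma> = (\<Sum>j\<leftarrow>\<gamma>. Poly_Mapping.single (i, j) 1)"

lemma row_monom_simps [simp]:
  "row_monom i [] = 0"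
  "row_monom i (j # \<gamma>) = Poly_Mapping.single (i, j) 1 + row_monom i \<gamma>"
  by (simp_all add: row_monom_def)

lemma keys_plus_nat:
  fixes m m' :: "'b \<Rightarrow>\<^sub>0 nat"
  shows "Poly_Mapping.keys (m + m') = Poly_Mapping.keys m \<union> Poly_Mapping.keys m'"
  by (auto simp: in_keys_iff lookup_add)

lemma keys_row_monom: "Poly_Mapping.keys (row_monom i \<gamma>) = Pair i ` set \<gamma>"
  by (induction \<gamma>) (auto simp: keys_plus_nat)

text \<open>Every derivative turns one coefficient into a multiple of itself at a smaller monomial.
  The multiple depends on repetitions in \<open>\<gamma>\<close> and is left out, as the lemma only
  serves to discard lists.\<close>

lemma lookup_foldr_partial_eq_0:
  "Poly_Mapping.lookup p (row_monom i \<gamma> + m) = 0 \<Longrightarrow>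
    Poly_Mapping.lookup (foldr (\<lambda>j. partial (i, j)) \<gamma> p) m = 0"
  by (induction \<gamma> arbitrary: m) (simp_all add: lookup_partial add_ac)

text \<open>The quotient of factorials is the falling factorial from differentiating a power s
  times. A general \<open>q\<close> is needed because each induction step raises it by one.\<close>

lemma lookup_foldr_partial_replicate:
  "Poly_Mapping.lookup (foldr (\<lambda>j. partial (i, j)) (replicate s i) p) (Poly_Mapping.single (i, i) q) =
    fact (q + s) / fact q * Poly_Mapping.lookup p (Poly_Mapping.single (i, i) (q + s))"
proof (induction s arbitrary: q)
  case (Suc s)
  let ?L = "\<lambda>n. Poly_Mapping.lookup p (Poly_Mapping.single (i, i) n)"
  have "Poly_Mapping.lookup (foldr (\<lambda>j. partial (i, j)) (replicate (Suc s) i) p) (Poly_Mapping.single (i, i) q) =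
     real (q + 1) * Poly_Mapping.lookup (foldr (\<lambda>j. partial (i, j)) (replicate s i) p)
        (Poly_Mapping.single (i, i) (Suc q))"
    by (simp add: lookup_partial single_add[symmetric] del: foldr_replicate)
  also have "\<dots> = real (q + 1) * (fact (Suc q + s) / fact (Suc q) * ?L (Suc q + s))"
    unfolding Suc.IH ..
  also have "\<dots> = fact (q + Suc s) / fact q * ?L (q + Suc s)"
    by (simp add: divide_simps)
  finally show ?case .
qed simp

lemma lookup_indet_mult:
  "Poly_Mapping.lookup (indet x * p) m =
    (if Poly_Mapping.lookup m x = 0 then 0
     else Poly_Mapping.lookup p (m - Poly_Mapping.single x 1))"
proof -
  have eq: "m = Poly_Mapping.single x 1 + b \<longleftrightarrow>
      Poly_Mapping.lookup m x \<noteq> 0 \<and> b = m - Poly_Mapping.single x 1" for b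
  proof
    assume "Poly_Mapping.lookup m x \<noteq> 0 \<and> b = m - Poly_Mapping.single x 1"
    then show "m = Poly_Mapping.single x 1 + b"
      by (intro poly_mapping_eqI) (auto simp: lookup_add lookup_minus lookup_single when_def)
  qed (auto simp: lookup_add)
  have "Poly_Mapping.lookup (indet x * p) m =
      Sum_any (\<lambda>b. Poly_Mapping.lookup p b when m = Poly_Mapping.single x 1 + b)"
    unfolding indet_def
    by (simp add: lookup_mult prod_fun_def lookup_single when_mult)
  also have "\<dots> = (if Poly_Mapping.lookup m x = 0 then 0
     else Poly_Mapping.lookup p (m - Poly_Mapping.single x 1))"
    unfolding eq by (auto simp: when_def cong: if_cong)
  finally show ?thesis .
qed

lemma keys_generic_power_0D:
  "m \<in> Poly_Mapping.keys (generic_power V 0 i j) \<Longrightarrow> m = 0 \<and> i = j"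
  by (auto split: if_splits)

lemma keys_generic_power_SucD:
  assumes "m \<in> Poly_Mapping.keys (generic_power V (Suc r) i j)"
  obtains l m' where "l \<in> V" "m' \<in> Poly_Mapping.keys (generic_power V r l j)"
    "m = Poly_Mapping.single (i, l) 1 + m'"
proof -
  from assms have "(\<Sum>l\<in>V. Poly_Mapping.lookup (indet (i, l) * generic_power V r l j) m) \<noteq> 0"
    by (simp add: in_keys_iff lookup_sum)
  then obtain l where l: "l \<in> V" "Poly_Mapping.lookup (indet (i, l) * generic_power V r l j) m \<noteq> 0"
    by (meson sum.not_neutral_contains_not_neutral)
  then have "Poly_Mapping.lookup m (i, l) \<noteq> 0"
    "Poly_Mapping.lookup (generic_power V r l j) (m - Poly_Mapping.single (i, l) 1) \<noteq> 0"
    by (auto simp: lookup_indet_mult split: if_splits)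
  moreover from this have "m = Poly_Mapping.single (i, l) 1 + (m - Poly_Mapping.single (i, l) 1)"
    by (intro poly_mapping_eqI) (auto simp: lookup_add lookup_minus lookup_single when_def)
  ultimately show thesis using that l by (auto simp: in_keys_iff)
qed

text \<open>The keys of such a monomial are the arcs of a walk from \<open>i\<close> to
  \<open>j\<close>. The first conjunct is what the induction needs: the head \<open>l\<close> of a
  prepended arc must be left by the remaining walk, unless that is empty.\<close>

lemma generic_power_leaves:
  assumes "m \<in> Poly_Mapping.keys (generic_power V r i j)"
  shows "(i = j \<and> r = 0 \<or> (\<exists>z. (i, z) \<in> Poly_Mapping.keys m) \<and> (\<exists>z. (z, j) \<in> Poly_Mapping.keys m)) \<and>
    (\<forall>x y. (x, y) \<in> Poly_Mapping.keys m \<longrightarrow> y = j \<or> (\<exists>z. (y, z) \<in> Poly_Mapping.keys m))"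
  using assms
proof (induction r arbitrary: i m)
  case 0
  from keys_generic_power_0D[OF this] show ?case by simp
next
  case (Suc r)
  from Suc.prems obtain l m' where m': "m' \<in> Poly_Mapping.keys (generic_power V r l j)"
    and m: "m = Poly_Mapping.single (i, l) 1 + m'" by (rule keys_generic_power_SucD)
  have k: "Poly_Mapping.keys m = insert (i, l) (Poly_Mapping.keys m')"
    by (simp add: m keys_plus_nat)
  show ?case using Suc.IH[OF m'] unfolding k by fast
qed

lemma trace_power_leaves:
  assumes "m \<in> Poly_Mapping.keys (trace_power V r)" "(x, y) \<in> Poly_Mapping.keys m"
  obtains z where "(y, z) \<in> Poly_Mapping.keys m"
proof -
  from assms(1) obtain i where i: "m \<in> Poly_Mapping.keys (generic_power V r i i)"
    unfolding trace_power_def in_keys_iff lookup_sum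
    by (meson sum.not_neutral_contains_not_neutral)
  have "r \<noteq> 0" using keys_generic_power_0D[of m V i i] i assms(2) by (cases "r = 0") auto
  with generic_power_leaves[OF i] assms(2) that show thesis by blast
qed

text \<open>Connectedness of a walk, in invariant form: no arc leads out of \<open>S\<close>, so the
  walk is trapped there. This excludes separate bunches of loops, which
  \<open>generic_power_leaves\<close> alone would permit.\<close>

lemma generic_power_stays:
  assumes "m \<in> Poly_Mapping.keys (generic_power V r i j)" "i \<in> S"
    and "\<And>x y. (x, y) \<in> Poly_Mapping.keys m \<Longrightarrow> x \<in> S \<Longrightarrow> y \<in> S"
  shows "Poly_Mapping.keys m \<subseteq> S \<times> UNIV"
  using assms
proof (induction r arbitrary: i m)
  case 0
  from keys_generic_power_0D[OF this(1)] show ?case by simp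
next
  case (Suc r)
  from Suc.prems(1) obtain l m' where m': "m' \<in> Poly_Mapping.keys (generic_power V r l j)"
    and m: "m = Poly_Mapping.single (i, l) 1 + m'" by (rule keys_generic_power_SucD)
  have k: "Poly_Mapping.keys m = insert (i, l) (Poly_Mapping.keys m')"
    by (simp add: m keys_plus_nat)
  have "l \<in> S" using Suc.prems k by blast
  then have "Poly_Mapping.keys m' \<subseteq> S \<times> UNIV"
    using Suc.IH[OF m'] Suc.prems(3) k by blast
  then show ?case using k Suc.prems(2) by auto
qed

lemma trace_power_start:
  assumes "m \<in> Poly_Mapping.keys (trace_power V r)" "m \<noteq> 0"
  shows "\<exists>s. (\<exists>z. (s, z) \<in> Poly_Mapping.keys m) \<and> (\<exists>z. (z, s) \<in> Poly_Mapping.keys m) \<and>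
    (\<forall>S. s \<in> S \<longrightarrow> (\<forall>x y. (x, y) \<in> Poly_Mapping.keys m \<longrightarrow> x \<in> S \<longrightarrow> y \<in> S) \<longrightarrow>
      Poly_Mapping.keys m \<subseteq> S \<times> UNIV)"
proof -
  obtain s where s: "m \<in> Poly_Mapping.keys (generic_power V r s s)"
    using assms(1) unfolding trace_power_def in_keys_iff lookup_sum
    by (meson sum.not_neutral_contains_not_neutral)
  have "r \<noteq> 0" using keys_generic_power_0D[of m V s s] s assms(2) by (cases "r = 0") auto
  then have "\<exists>z. (s, z) \<in> Poly_Mapping.keys m" "\<exists>z. (z, s) \<in> Poly_Mapping.keys m"
    using generic_power_leaves[OF s] by auto
  moreover have "\<forall>S. s \<in> S \<longrightarrow> (\<forall>x y. (x, y) \<in> Poly_Mapping.keys m \<longrightarrow> x \<in> S \<longrightarrow> y \<in> S) \<longrightarrow>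
      Poly_Mapping.keys m \<subseteq> S \<times> UNIV"
    using generic_power_stays[OF s] by metis
  ultimately show ?thesis by metis
qed

text \<open>If the only arc out of the start \<open>s\<close> were a loop, the walk would be trapped
  in \<open>{s}\<close> and miss the other row. So the start is left for the other vertex, and the
  other arc has to lead back.\<close>

lemma trace_power_two_arcs:
  assumes "Poly_Mapping.lookup (trace_power V r) m \<noteq> 0" "Poly_Mapping.keys m = {(i, a), (j, b)}"
    and "i \<noteq> j" "a \<in> {i, j}" "b \<in> {i, j}"
  shows "a = j \<and> b = i"
proof -
  have "m \<in> Poly_Mapping.keys (trace_power V r)" "m \<noteq> 0"
    using assms(1,2) by (auto simp: in_keys_iff)
  from trace_power_start[OF this] obtain s where "\<exists>z. (s, z) \<in> Poly_Mapping.keys m"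
    "\<exists>z. (z, s) \<in> Poly_Mapping.keys m"
    and *: "\<And>S. s \<in> S \<Longrightarrow> (\<forall>x y. (x, y) \<in> Poly_Mapping.keys m \<longrightarrow> x \<in> S \<longrightarrow> y \<in> S) \<Longrightarrow>
      Poly_Mapping.keys m \<subseteq> S \<times> UNIV"
    by metis
  then have "s = i \<or> s = j" "s = a \<or> s = b" using assms(2) by auto
  moreover have "\<not> (s = i \<and> a = i)" "\<not> (s = j \<and> b = j)"
    using *[of "{s}"] unfolding assms(2) using assms(3) by blast+
  ultimately show ?thesis using assms(3-5) by blast
qed

text \<open>The only walk with this monomial repeats the loop at \<open>i\<close>; for
  \<open>r = 0\<close> the identity matrix remains.\<close>

lemma lookup_generic_power_diag:
  "finite V \<Longrightarrow> i \<in> V \<Longrightarrow> Poly_Mapping.lookup (generic_power V r l j) (Poly_Mapping.single (i, i) r) =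
    (if l = j \<and> (r = 0 \<or> l = i) then 1 else 0)"
proof (induction r arbitrary: l)
  case 0
  then show ?case by (simp add: lookup_one)
next
  case (Suc r)
  have eq: "Poly_Mapping.single (i, i) (Suc r) - Poly_Mapping.single (i, i) 1 = Poly_Mapping.single (i, i) r"
    by (intro poly_mapping_eqI) (auto simp: lookup_minus lookup_single when_def)
  have "Poly_Mapping.lookup (generic_power V (Suc r) l j) (Poly_Mapping.single (i, i) (Suc r)) =
     (\<Sum>l'\<in>V. if l' = i then (if l = i then Poly_Mapping.lookup (generic_power V r i j) (Poly_Mapping.single (i, i) r) else 0) else 0)"
    unfolding generic_power.simps lookup_sum lookup_indet_mult
    by (rule sum.cong) (auto simp: lookup_single when_def eq[simplified] simp del: generic_power.simps)
  also have "\<dots> = (if l = i then Poly_Mapping.lookup (generic_power V r i j) (Poly_Mapping.single (i, i) r) else 0)"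
    using Suc.prems by simp
  finally show ?case using Suc.IH[of i] Suc.prems by auto
qed

lemma lookup_trace_power_diag:
  assumes "finite V" "i \<in> V" "r > 0"
  shows "Poly_Mapping.lookup (trace_power V r) (Poly_Mapping.single (i, i) r) = 1"
  using assms by (simp add: trace_power_def lookup_sum lookup_generic_power_diag)

text \<open>The value 2 counts the two starting points of the closed walk i, j, i.\<close>

lemma lookup_trace_power_2:
  assumes "finite V" "i \<in> V" "j \<in> V" "i \<noteq> j"
  shows "Poly_Mapping.lookup (trace_power V 2)
    (Poly_Mapping.single (i, j) 1 + Poly_Mapping.single (j, i) 1) = 2" (is "Poly_Mapping.lookup _ ?m = _")
proof -
  have g1: "generic_power V (Suc 0) l s = indet (l, s)" if "s \<in> V" for l s
    using that assms(1) by (simp add: if_distrib cong: if_cong)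
  have iff: "Poly_Mapping.single (s, l) 1 + Poly_Mapping.single (l, s) 1 = ?m \<longleftrightarrow>
      (s = i \<and> l = j \<or> s = j \<and> l = i)" (is "?n = _ \<longleftrightarrow> _") for s l
  proof
    assume "?n = ?m"
    then have "Poly_Mapping.keys ?n = Poly_Mapping.keys ?m" by simp
    then show "s = i \<and> l = j \<or> s = j \<and> l = i" by (auto simp: keys_plus_nat)
  qed (auto simp: add.commute)
  have "Poly_Mapping.lookup (trace_power V 2) ?m =
     (\<Sum>s\<in>V. \<Sum>l\<in>V. Poly_Mapping.lookup (indet (s, l) * indet (l, s)) ?m)"
    unfolding trace_power_def lookup_sum numeral_2_eq_2
    by (rule sum.cong[OF refl], subst generic_power.simps) (simp add: lookup_sum g1 del: generic_power.simps)
  also have "\<dots> = (\<Sum>s\<in>V. \<Sum>l\<in>V. if s = i \<and> l = j \<or> s = j \<and> l = i then 1 else 0)"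
    using iff by (simp add: indet_def mult_single lookup_single when_def)
  also have "\<dots> = (\<Sum>s\<in>V. (if s = i then 1 else 0) + (if s = j then 1 else 0))"
  proof (rule sum.cong[OF refl])
    fix s assume "s \<in> V"
    have "(if s = i \<and> l = j \<or> s = j \<and> l = i then 1 else 0 :: real) =
      (if l = j then if s = i then 1 else 0 else 0) + (if l = i then if s = j then 1 else 0 else 0)" for l
      using assms by auto
    then show "(\<Sum>l\<in>V. if s = i \<and> l = j \<or> s = j \<and> l = i then 1 else 0) = (if s = i then 1 else 0) + (if s = j then 1 else 0 :: real)"
      using assms by (simp add: sum.distrib)
  qed
  also have "\<dots> = 2" using assms by (simp add: sum.distrib)
  finally show ?thesis .
qed

section \<open>Row operators applied to traces of powers\<close>

abbreviation tuples :: "nat \<Rightarrow> 'a set \<Rightarrow> 'a list set" where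
  "tuples r V \<equiv> {\<gamma>. set \<gamma> \<subseteq> V \<and> length \<gamma> = r}"

lemma lookup_row_op:
  "Poly_Mapping.lookup (row_op k V T i p) m =
    (\<Sum>\<gamma>\<in>tuples (k - 1) V. T (i # \<gamma>) * Poly_Mapping.lookup (foldr (\<lambda>j. partial (i, j)) \<gamma> p) m)"
  by (simp add: row_op_def lookup_sum lookup_const_mult)

lemma lookup_row_op_row_op:
  "Poly_Mapping.lookup (row_op k V T i (row_op k V T j p)) m =
    (\<Sum>(\<gamma>, \<gamma>')\<in>tuples (k - 1) V \<times> tuples (k - 1) V. T (i # \<gamma>) * T (j # \<gamma>') *
      Poly_Mapping.lookup (foldr (\<lambda>l. partial (i, l)) \<gamma> (foldr (\<lambda>l. partial (j, l)) \<gamma>' p)) m)"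
  unfolding lookup_row_op row_op_def[of k V T j] foldr_partial_sum foldr_partial_const_mult
    lookup_sum lookup_const_mult
  by (simp add: sum_distrib_left sum.cartesian_product mult.assoc)

lemma lookup_foldr_foldr_partial_eq_0:
  "Poly_Mapping.lookup p (row_monom i \<gamma> + row_monom j \<gamma>') = 0 \<Longrightarrow>
    Poly_Mapping.lookup (foldr (\<lambda>l. partial (i, l)) \<gamma> (foldr (\<lambda>l. partial (j, l)) \<gamma>' p)) 0 = 0"
  by (intro lookup_foldr_partial_eq_0) (simp add: add.commute)

text \<open>A closed walk that only ever leaves from \<open>i\<close> and \<open>j\<close> stays in \<open>{i, j}\<close>.\<close>

lemma lookup_trace_power_rows:
  assumes "Poly_Mapping.lookup (trace_power V r) (row_monom i \<gamma> + row_monom j \<gamma>') \<noteq> 0"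
  shows "set \<gamma> \<subseteq> {i, j} \<and> set \<gamma>' \<subseteq> {i, j}"
proof -
  let ?m = "row_monom i \<gamma> + row_monom j \<gamma>'"
  have k: "Poly_Mapping.keys ?m = Pair i ` set \<gamma> \<union> Pair j ` set \<gamma>'"
    by (simp add: keys_plus_nat keys_row_monom)
  have "y \<in> {i, j}" if xy: "(x, y) \<in> Poly_Mapping.keys ?m" for x y
  proof -
    from assms have "?m \<in> Poly_Mapping.keys (trace_power V r)" by (simp add: in_keys_iff)
    then obtain z where "(y, z) \<in> Poly_Mapping.keys ?m"
      using xy by (rule trace_power_leaves)
    then show ?thesis unfolding k by auto
  qed
  then show ?thesis unfolding k by blast
qed

lemma subset_singleton_replicate: "set xs \<subseteq> {a} \<Longrightarrow> xs = replicate (length xs) a"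
  by (simp add: replicate_eqI subset_iff)

lemma Cons_replicate_pred: "k > 0 \<Longrightarrow> i # replicate (k - 1) i = replicate k i"
  by (cases k) simp_all

text \<open>All arcs leave from \<open>i\<close>, so the walk consists of loops at \<open>i\<close>
  and only the constant list survives. The factorial comes from differentiating the power of that
  loop variable.\<close>

lemma row_op_trace_power:
  assumes "finite V" "i \<in> V" "2 \<le> k"
  shows "Poly_Mapping.lookup (row_op k V T i (trace_power V (k - 1))) 0 = T (replicate k i) * fact (k - 1)"
proof -
  let ?p = "trace_power V (k - 1)" and ?R = "replicate (k - 1) i"
  have "Poly_Mapping.lookup (row_op k V T i ?p) 0 =
     (\<Sum>\<gamma>\<in>{?R}. T (i # \<gamma>) * Poly_Mapping.lookup (foldr (\<lambda>j. partial (i, j)) \<gamma> ?p) 0)"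
    unfolding lookup_row_op
  proof (rule sum.mono_neutral_right)
    show "\<forall>\<gamma>\<in>tuples (k - 1) V - {?R}. T (i # \<gamma>) * Poly_Mapping.lookup (foldr (\<lambda>j. partial (i, j)) \<gamma> ?p) 0 = 0"
    proof
      fix \<gamma> assume g: "\<gamma> \<in> tuples (k - 1) V - {?R}"
      then have "\<not> set \<gamma> \<subseteq> {i}" using subset_singleton_replicate by fastforce
      \<comment> \<open>The bound for two rows is used with the second row equal to the first and
        its list empty.\<close>
      then have "Poly_Mapping.lookup ?p (row_monom i \<gamma> + 0) = 0"
        using lookup_trace_power_rows[of V "k - 1" i \<gamma> i "[]"] by auto
      then show "T (i # \<gamma>) * Poly_Mapping.lookup (foldr (\<lambda>j. partial (i, j)) \<gamma> ?p) 0 = 0"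
        by (simp only: lookup_foldr_partial_eq_0 mult_zero_right)
    qed
  qed (use assms in \<open>auto simp: finite_lists_length_eq\<close>)
  also have "\<dots> = T (replicate k i) * fact (k - 1)"
    using lookup_foldr_partial_replicate[of i "k - 1" ?p 0] assms
    by (simp add: lookup_trace_power_diag Cons_replicate_pred del: foldr_replicate One_nat_def)
  finally show ?thesis .
qed

lemma row_op_square_trace_power:
  assumes "finite V" "i \<in> V" "2 \<le> k"
  shows "Poly_Mapping.lookup (row_op k V T i (row_op k V T i (trace_power V (2 * (k - 1))))) 0 =
    (T (replicate k i))\<^sup>2 * fact (2 * (k - 1))"
proof -
  let ?p = "trace_power V (2 * (k - 1))" and ?R = "replicate (k - 1) i"
  let ?f = "\<lambda>(\<gamma>, \<gamma>'). T (i # \<gamma>) * T (i # \<gamma>') *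
      Poly_Mapping.lookup (foldr (\<lambda>l. partial (i, l)) \<gamma> (foldr (\<lambda>l. partial (i, l)) \<gamma>' ?p)) 0"
  have "Poly_Mapping.lookup (row_op k V T i (row_op k V T i ?p)) 0 = sum ?f {(?R, ?R)}"
    unfolding lookup_row_op_row_op
  proof (rule sum.mono_neutral_right)
    show "\<forall>x\<in>tuples (k - 1) V \<times> tuples (k - 1) V - {(?R, ?R)}. ?f x = 0"
    proof
      fix x assume x: "x \<in> tuples (k - 1) V \<times> tuples (k - 1) V - {(?R, ?R)}"
      obtain \<gamma> \<gamma>' where x_eq: "x = (\<gamma>, \<gamma>')" by (cases x)
      have "length \<gamma> = k - 1" "length \<gamma>' = k - 1" "(\<gamma>, \<gamma>') \<noteq> (?R, ?R)"
        using x unfolding x_eq by blast+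
      then have "\<not> (set \<gamma> \<subseteq> {i} \<and> set \<gamma>' \<subseteq> {i})" using subset_singleton_replicate by metis
      then have "Poly_Mapping.lookup ?p (row_monom i \<gamma> + row_monom i \<gamma>') = 0"
        using lookup_trace_power_rows[of V "2 * (k - 1)" i \<gamma> i \<gamma>'] by auto
      then show "?f x = 0" by (simp only: x_eq lookup_foldr_foldr_partial_eq_0 prod.case mult_zero_right)
    qed
  qed (use assms in \<open>auto simp: finite_lists_length_eq\<close>)
  also have "\<dots> = (T (i # ?R))\<^sup>2 * Poly_Mapping.lookup
      (foldr (\<lambda>l. partial (i, l)) (replicate (2 * (k - 1)) i) ?p) (Poly_Mapping.single (i, i) 0)"
    by (simp only: sum.insert_remove[OF finite.emptyI] sum.empty finite.emptyI empty_Diff prod.case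
        add_0_right power2_eq_square mult_2 replicate_add foldr_append o_apply single_zero)
  also have "\<dots> = (T (replicate k i))\<^sup>2 * fact (2 * (k - 1))"
    unfolding lookup_foldr_partial_replicate using assms
    by (simp add: lookup_trace_power_diag Cons_replicate_pred del: foldr_replicate One_nat_def)
  finally show ?thesis .
qed


text \<open>For \<open>k \<noteq> 2\<close> the hypothesis \<open>T\<close> leaves only constant
  lists, that is, loops at \<open>i\<close> and loops at \<open>j\<close>, which form no single
  closed walk. For \<open>k = 2\<close> the walk i, j, i is the only one that uses both
  rows.\<close>

lemma row_op_row_op_trace_power:
  assumes "finite V" "i \<in> V" "j \<in> V" "i \<noteq> j" "2 \<le> k"
    and T: "\<And>l \<gamma>. l \<in> {i, j} \<Longrightarrow> length \<gamma> = k - 1 \<Longrightarrow> T (l # \<gamma>) \<noteq> 0 \<Longrightarrow> set \<gamma> \<subseteq> {i, j} \<Longrightarrow>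
      \<gamma> = replicate (k - 1) l \<or> k = 2"
  shows "Poly_Mapping.lookup (row_op k V T i (row_op k V T j (trace_power V (2 * (k - 1))))) 0 =
    (if k = 2 then 2 * T [i, j] * T [j, i] else 0)"
proof -
  let ?p = "trace_power V (2 * (k - 1))"
  let ?f = "\<lambda>(\<gamma>, \<gamma>'). T (i # \<gamma>) * T (j # \<gamma>') *
      Poly_Mapping.lookup (foldr (\<lambda>l. partial (i, l)) \<gamma> (foldr (\<lambda>l. partial (j, l)) \<gamma>' ?p)) 0"
  have diag: "Poly_Mapping.lookup (trace_power V r)
      (row_monom i (replicate (k - 1) i) + row_monom j (replicate (k - 1) j)) = 0" for r
    using trace_power_two_arcs[of V r _ i i j j] assms
    by (fastforce simp: keys_plus_nat keys_row_monom)
  show ?thesis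
  proof (cases "k = 2")
    case False
    have "?f (\<gamma>, \<gamma>') = 0" if l: "length \<gamma> = k - 1" "length \<gamma>' = k - 1" for \<gamma> \<gamma>'
    proof (cases "T (i # \<gamma>) = 0 \<or> T (j # \<gamma>') = 0")
      case nz: False
      have "Poly_Mapping.lookup ?p (row_monom i \<gamma> + row_monom j \<gamma>') = 0"
      proof (rule ccontr)
        assume n0: "\<not> ?thesis"
        then have "set \<gamma> \<subseteq> {i, j}" "set \<gamma>' \<subseteq> {i, j}" using lookup_trace_power_rows by metis+
        then have "\<gamma> = replicate (k - 1) i" "\<gamma>' = replicate (k - 1) j"
          using T[of i \<gamma>] T[of j \<gamma>'] assms nz l False by blast+
        with n0 diag show False by simp
      qed
      then show ?thesis by (simp only: lookup_foldr_foldr_partial_eq_0 prod.case mult_zero_right)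
    qed auto
    then have "sum ?f (tuples (k - 1) V \<times> tuples (k - 1) V) = 0" by (intro sum.neutral) blast
    with False show ?thesis unfolding lookup_row_op_row_op by simp
  next
    case True
    have "Poly_Mapping.lookup (row_op k V T i (row_op k V T j ?p)) 0 = sum ?f {([j], [i])}"
      unfolding lookup_row_op_row_op
    proof (rule sum.mono_neutral_right)
      show "\<forall>x\<in>tuples (k - 1) V \<times> tuples (k - 1) V - {([j], [i])}. ?f x = 0"
      proof
        fix x assume x: "x \<in> tuples (k - 1) V \<times> tuples (k - 1) V - {([j], [i])}"
        then obtain a b where x_eq: "x = ([a], [b])" and ab: "a \<noteq> j \<or> b \<noteq> i"
          using True by (auto simp: length_Suc_conv numeral_2_eq_2)
        have "Poly_Mapping.lookup ?p (row_monom i [a] + row_monom j [b]) = 0"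
          using trace_power_two_arcs[of V "2 * (k - 1)" "row_monom i [a] + row_monom j [b]" i a j b]
            lookup_trace_power_rows[of V "2 * (k - 1)" i "[a]" j "[b]"] ab assms(4)
          by (auto simp: keys_plus_nat)
        then show "?f x = 0" by (simp only: x_eq lookup_foldr_foldr_partial_eq_0 prod.case mult_zero_right)
      qed
    qed (use assms True in \<open>auto simp: finite_lists_length_eq\<close>)
    also have "\<dots> = 2 * T [i, j] * T [j, i]"
      using assms lookup_trace_power_2[of V i j] True
      by (simp add: lookup_partial lookup_add lookup_single add.commute numeral_2_eq_2)
    finally show ?thesis using True by simp
  qed
qed

section \<open>The first two traces\<close>

lemma total_op_supp:
  assumes "finite V" "S \<subseteq> V" "\<And>i. i \<in> V - S \<Longrightarrow> \<delta> i = 0"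
  shows "total_op k V T \<delta> p = Finite_Set.fold (\<lambda>i. row_op k V T i ^^ \<delta> i) p S"
proof -
  let ?f = "\<lambda>i. row_op k V T i ^^ \<delta> i"
  interpret comp_fun_commute ?f by (rule row_op_comp_fun_commute)
  have *: "Finite_Set.fold ?f p (S \<union> B) = Finite_Set.fold ?f p S" if "finite B" "B \<subseteq> V - S" for B
    using that
  proof (induction rule: finite_induct)
    case (insert x B)
    then have "Finite_Set.fold ?f p (insert x (S \<union> B)) = ?f x (Finite_Set.fold ?f p (S \<union> B))"
      using assms(1,2) finite_subset[of S V] by (intro fold_insert) auto
    then show ?case using insert assms(3)[of x] by simp
  qed simp
  have "S \<union> (V - S) = V" using assms(2) by blast
  then show ?thesis unfolding total_op_def using *[of "V - S"] assms(1) by simp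
qed

lemma total_op_single:
  assumes "finite V" "i \<in> V" "\<And>j. j \<noteq> i \<Longrightarrow> \<delta> j = 0"
  shows "total_op k V T \<delta> p = (row_op k V T i ^^ \<delta> i) p"
proof -
  interpret comp_fun_commute "\<lambda>i. row_op k V T i ^^ \<delta> i" by (rule row_op_comp_fun_commute)
  show ?thesis using assms total_op_supp[of V "{i}" \<delta> k T p] fold_insert[of "{}" i p] by simp
qed

lemma total_op_pair:
  assumes "finite V" "i \<in> V" "j \<in> V" "i \<noteq> j" "\<And>l. l \<notin> {i, j} \<Longrightarrow> \<delta> l = 0" "\<delta> i = 1" "\<delta> j = 1"
  shows "total_op k V T \<delta> p = row_op k V T i (row_op k V T j p)"
proof -
  interpret comp_fun_commute "\<lambda>i. row_op k V T i ^^ \<delta> i" by (rule row_op_comp_fun_commute)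
  have "Finite_Set.fold (\<lambda>i. row_op k V T i ^^ \<delta> i) p {i, j} = row_op k V T i (row_op k V T j p)"
    using assms(4,6,7) fold_insert[of "{j}" i p] fold_insert[of "{}" j p] by simp
  then show ?thesis using assms total_op_supp[of V "{i, j}" \<delta> k T p] by simp
qed

lemma weights_1:
  assumes "finite V"
  shows "{\<delta> :: 'a \<Rightarrow> nat. (\<forall>i. i \<notin> V \<longrightarrow> \<delta> i = 0) \<and> (\<Sum>i\<in>V. \<delta> i) = 1} = (\<lambda>i j. if j = i then 1 else 0) ` V"
    (is "?L = ?R")
proof
  show "?L \<subseteq> ?R"
  proof
    fix \<delta> :: "'a \<Rightarrow> nat" assume d: "\<delta> \<in> ?L"
    then have "(\<Sum>i\<in>V. \<delta> i) = 1" by blast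
    then obtain i where i: "i \<in> V" "\<delta> i = 1" "\<forall>j\<in>V. i \<noteq> j \<longrightarrow> \<delta> j = 0"
      using sum_eq_1_iff[OF assms, of \<delta>] by auto
    then have "\<delta> = (\<lambda>j. if j = i then 1 else 0)" using d by fastforce
    then show "\<delta> \<in> ?R" using i by blast
  qed
  show "?R \<subseteq> ?L" using assms by auto
qed

text \<open>Pairs are indexed by 2-subsets rather than by ordered pairs: each weight function then
  occurs once, and for \<open>k = 2\<close> the index set can be compared with the edges.\<close>

lemma weights_2:
  assumes "finite V"
  shows "{\<delta> :: 'a \<Rightarrow> nat. (\<forall>i. i \<notin> V \<longrightarrow> \<delta> i = 0) \<and> (\<Sum>i\<in>V. \<delta> i) = 2} =
    (\<lambda>i j. if j = i then 2 else 0) ` V \<union> (\<lambda>S j. if j \<in> S then 1 else 0) ` {S. S \<subseteq> V \<and> card S = 2}"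
    (is "?L = ?R1 \<union> ?R2")
proof
  show "?L \<subseteq> ?R1 \<union> ?R2"
  proof
    fix \<delta> :: "'a \<Rightarrow> nat" assume d: "\<delta> \<in> ?L"
    show "\<delta> \<in> ?R1 \<union> ?R2"
    proof (cases "\<exists>i\<in>V. \<delta> i \<ge> 2")
      case True
      then obtain i where i: "i \<in> V" "\<delta> i \<ge> 2" by blast
      then have s: "\<delta> i + (\<Sum>j\<in>V - {i}. \<delta> j) = 2" using d assms by (simp add: sum.remove[of V i])
      have "(\<Sum>j\<in>V - {i}. \<delta> j) = 0" "\<delta> i = 2" using s i by linarith+
      moreover from this have "\<forall>j\<in>V - {i}. \<delta> j = 0" using assms by simp
      ultimately have "\<delta> = (\<lambda>j. if j = i then 2 else 0)" using d by fastforce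
      then show ?thesis using i by blast
    next
      case False
      let ?S = "{i \<in> V. \<delta> i = 1}"
      have v: "\<delta> j = (if j \<in> ?S then 1 else 0)" for j
      proof (cases "j \<in> V")
        case True
        with False have "\<delta> j < 2" by force
        with True show ?thesis by auto
      qed (use d in auto)
      have "(\<Sum>i\<in>V. \<delta> i) = (\<Sum>i\<in>V. if i \<in> ?S then 1 else 0)" by (intro sum.cong refl) (rule v)
      also have "\<dots> = card ?S" using assms by (simp add: sum.If_cases Int_def)
      finally have "card ?S = 2" using d by simp
      moreover have "\<delta> = (\<lambda>j. if j \<in> ?S then 1 else 0)" using v by blast
      ultimately show ?thesis by blast
    qed
  qed
  have "(\<Sum>i\<in>V. if i \<in> S then 1 else 0) = card S" if "S \<subseteq> V" for S
    using that assms by (simp add: sum.If_cases Int_absorb1)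
  then show "?R1 \<union> ?R2 \<subseteq> ?L"
    by (intro Un_least image_subsetI CollectI conjI) (use assms in auto)
qed

lemma A_alpha_replicate:
  assumes "uniform k H" "2 \<le> k"
  shows "A_alpha k \<alpha> H (replicate k i) = \<alpha> * real (degree H i)"
proof -
  \<comment> \<open>A constant list has a one-element set, too small for an edge.\<close>
  have "set (replicate k i) \<notin> edges H" using assms by (auto simp: uniform_def)
  moreover have "hd (replicate k i) = i" using assms(2) by (cases k) auto
  ultimately show ?thesis by (simp add: A_alpha_def degree_tensor_def adjacency_tensor_def)
qed

lemma A_alpha_not_replicate:
  assumes "is \<noteq> replicate k (hd is)"
  shows "A_alpha k \<alpha> H is = (if set is \<in> edges H then (1 - \<alpha>) / fact (k - 1) else 0)"
  using assms by (simp add: A_alpha_def degree_tensor_def adjacency_tensor_def)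

text \<open>A nonzero entry off the diagonal requires an edge, whose \<open>k\<close> vertices would
  have to fit into \<open>{i, j}\<close>. This supplies the hypothesis \<open>T\<close> of
  \<open>row_op_row_op_trace_power\<close>.\<close>

lemma A_alpha_within_pair:
  assumes "uniform k H" "2 \<le> k" "l \<in> {i, j}" "length \<gamma> = k - 1" "A_alpha k \<alpha> H (l # \<gamma>) \<noteq> 0" "set \<gamma> \<subseteq> {i, j}"
  shows "\<gamma> = replicate (k - 1) l \<or> k = 2"
proof (rule ccontr)
  assume c: "\<not> ?thesis"
  then have "l # \<gamma> \<noteq> replicate k (hd (l # \<gamma>))" using assms(2) by (cases k) auto
  then have "set (l # \<gamma>) \<in> edges H" using assms(5) by (auto simp: A_alpha_not_replicate split: if_splits)
  then have "card (set (l # \<gamma>)) = k" using assms(1) by (auto simp: uniform_def)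
  moreover have "card (set (l # \<gamma>)) \<le> card {i, j}" using assms by (intro card_mono) auto
  moreover have "card {i, j} \<le> 2" by (simp add: card_insert_if)
  ultimately show False using c assms(2) by linarith
qed

lemma Tr_1:
  assumes "hypergraph H" "uniform k H" "2 \<le> k"
  shows "Tr k (verts H) (A_alpha k \<alpha> H) 1 =
    real ((k - 1) ^ (card (verts H) - 1)) * (\<alpha> * real (\<Sum>v\<in>verts H. degree H v))"
proof -
  let ?V = "verts H" and ?T = "A_alpha k \<alpha> H"
  have V: "finite ?V" using assms by (simp add: hypergraph_def)
  let ?d = "\<lambda>i j. if j = i then 1 else 0 :: nat"
  let ?g = "\<lambda>\<delta>. (\<Prod>i\<in>?V. 1 / fact (\<delta> i * (k - 1))) *
           Poly_Mapping.lookup (total_op k ?V ?T \<delta> (trace_power ?V (1 * (k - 1)))) 0 :: real"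
  have inj: "inj_on ?d ?V" by (rule inj_onI) (metis zero_neq_one)
  have "?g (?d i) = \<alpha> * real (degree H i)" if i: "i \<in> ?V" for i
  proof -
    have "(\<Prod>j\<in>?V. 1 / fact (?d i j * (k - 1)) :: real) = (\<Prod>j\<in>?V. if j = i then 1 / fact (k - 1) else 1)"
      by (rule prod.cong) auto
    also have "\<dots> = 1 / fact (k - 1)" using i V by simp
    finally have "(\<Prod>j\<in>?V. 1 / fact (?d i j * (k - 1)) :: real) = 1 / fact (k - 1)" .
    moreover have "total_op k ?V ?T (?d i) p = row_op k ?V ?T i p" for p
      using total_op_single[of ?V i "?d i" k ?T p] i V by simp
    ultimately show ?thesis using row_op_trace_power[of ?V i k ?T] V i assms
      by (simp add: A_alpha_replicate)
  qed
  then have "sum ?g (?d ` ?V) = (\<Sum>i\<in>?V. \<alpha> * real (degree H i))"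
    by (simp only: sum.reindex[OF inj] o_def cong: sum.cong)
  then show ?thesis unfolding Tr_def weights_1[OF V] by (simp add: sum_distrib_left)
qed

text \<open>Weight two on one vertex yields its squared diagonal entry, all factorials cancelling. A
  pair contributes the product of its two off-diagonal entries, doubled for the two starting points,
  and this only if it is an edge and \<open>k = 2\<close>.\<close>

lemma Tr_2:
  fixes H :: "'a hypergraph"
  assumes "hypergraph H" "uniform k H" "2 \<le> k"
  shows "Tr k (verts H) (A_alpha k \<alpha> H) 2 =
    real ((k - 1) ^ (card (verts H) - 1)) *
      (\<alpha>\<^sup>2 * real (\<Sum>v\<in>verts H. (degree H v)\<^sup>2) +
       (if k = 2 then 2 * (1 - \<alpha>)\<^sup>2 * real (card (edges H)) else 0))"
proof -
  let ?V = "verts H" and ?T = "A_alpha k \<alpha> H"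
  have V: "finite ?V" using assms by (simp add: hypergraph_def)
  let ?d = "\<lambda>i j. if j = i then 2 else 0 :: nat" and ?e = "\<lambda>S j. if j \<in> S then 1 else 0 :: nat"
  let ?P = "{S. S \<subseteq> ?V \<and> card S = 2}"
  let ?g = "\<lambda>\<delta>. (\<Prod>i\<in>?V. 1 / fact (\<delta> i * (k - 1))) *
           Poly_Mapping.lookup (total_op k ?V ?T \<delta> (trace_power ?V (2 * (k - 1)))) 0 :: real"
  have inj1: "inj_on ?d ?V" by (rule inj_onI) (metis zero_neq_numeral)
  have inj2: "inj_on ?e ?P"
  proof (rule inj_onI)
    fix S S' assume "?e S = ?e S'"
    then have "?e S j = ?e S' j" for j by metis
    then show "S = S'" by (metis (mono_tags) equalityI subsetI zero_neq_one)
  qed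
  have disj: "?d ` ?V \<inter> ?e ` ?P = {}"
  proof (rule equals0I)
    fix \<delta> assume "\<delta> \<in> ?d ` ?V \<inter> ?e ` ?P"
    then obtain i S where "\<delta> = ?d i" "\<delta> = ?e S" by (elim IntE imageE) (rule that)
    then have "?d i i = ?e S i" by metis
    then show False by (simp split: if_splits)
  qed
  have fin: "finite ?P" using V by simp
  have g1: "?g (?d i) = \<alpha>\<^sup>2 * real ((degree H i)\<^sup>2)" if i: "i \<in> ?V" for i
  proof -
    have "(\<Prod>j\<in>?V. 1 / fact (?d i j * (k - 1)) :: real) = (\<Prod>j\<in>?V. if j = i then 1 / fact (2 * (k - 1)) else 1)"
      by (rule prod.cong) auto
    also have "\<dots> = 1 / fact (2 * (k - 1))" using i V by simp
    finally have "(\<Prod>j\<in>?V. 1 / fact (?d i j * (k - 1)) :: real) = 1 / fact (2 * (k - 1))" .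
    moreover have "total_op k ?V ?T (?d i) p = row_op k ?V ?T i (row_op k ?V ?T i p)" for p
      using total_op_single[of ?V i "?d i" k ?T p] i V by (simp add: numeral_2_eq_2)
    ultimately show ?thesis using row_op_square_trace_power[of ?V i k ?T] V i assms
      by (simp add: A_alpha_replicate power_mult_distrib)
  qed
  have g2: "?g (?e S) = (if k = 2 \<and> S \<in> edges H then 2 * (1 - \<alpha>)\<^sup>2 else 0)" if S: "S \<in> ?P" for S
  proof -
    from S obtain i j where ij: "S = {i, j}" "i \<noteq> j" "i \<in> ?V" "j \<in> ?V"
      by (auto simp: card_2_iff)
    have total: "total_op k ?V ?T (?e S) p = row_op k ?V ?T i (row_op k ?V ?T j p)" for p
      using ij by (intro total_op_pair[OF V]) auto
    have "Poly_Mapping.lookup (row_op k ?V ?T i (row_op k ?V ?T j (trace_power ?V (2 * (k - 1))))) 0 =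
        (if k = 2 then 2 * ?T [i, j] * ?T [j, i] else 0)"
      by (rule row_op_row_op_trace_power[OF V ij(3,4,2) assms(3) A_alpha_within_pair[OF assms(2,3)]])
    moreover have "?T [i, j] = (if S \<in> edges H then 1 - \<alpha> else 0)" 
      "?T [j, i] = (if S \<in> edges H then 1 - \<alpha> else 0)" if "k = 2"
      using that ij by (auto simp: A_alpha_not_replicate numeral_2_eq_2 insert_commute)
    moreover have "(\<Prod>l\<in>?V. 1 / fact (?e S l * (k - 1)) :: real) = 1" if "k = 2"
      by (rule prod.neutral) (simp add: that)
    ultimately show ?thesis unfolding total by (cases "k = 2") (simp_all add: power2_eq_square)
  qed
  have E: "edges H \<subseteq> ?P" if "k = 2" using assms that by (auto simp: hypergraph_def uniform_def)
  have "sum ?g (?d ` ?V \<union> ?e ` ?P) = sum ?g (?d ` ?V) + sum ?g (?e ` ?P)"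
    using disj V fin by (intro sum.union_disjoint) auto
  also have "sum ?g (?d ` ?V) = (\<Sum>i\<in>?V. \<alpha>\<^sup>2 * real ((degree H i)\<^sup>2))"
    by (simp only: sum.reindex[OF inj1] o_def g1 cong: sum.cong)
  also have "sum ?g (?e ` ?P) = (\<Sum>S\<in>?P. if k = 2 \<and> S \<in> edges H then 2 * (1 - \<alpha>)\<^sup>2 else 0)"
    by (simp only: sum.reindex[OF inj2] o_def g2 cong: sum.cong)
  also have "\<dots> = (if k = 2 then 2 * (1 - \<alpha>)\<^sup>2 * real (card (edges H)) else 0)"
    using E fin by (cases "k = 2") (simp_all add: sum.If_cases Int_absorb1 Int_def[symmetric])
  finally show ?thesis unfolding Tr_def weights_2[OF V] by (simp add: sum_distrib_left)
qed

section \<open>Counting the vertices of a unicyclic hypergraph\<close>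

abbreviation adj :: "'a set set \<Rightarrow> ('a \<times> 'a) set" where
  "adj F \<equiv> {(x, y). \<exists>e\<in>F. x \<in> e \<and> y \<in> e}"

text \<open>Only covered vertices are compared, and only edges of \<open>F\<close> may be used, so
  that the notion applies to proper subsets of the edges.\<close>

definition connected_edges :: "'a set set \<Rightarrow> bool" where
  "connected_edges F \<longleftrightarrow> (\<forall>u\<in>\<Union>F. \<forall>v\<in>\<Union>F. (u, v) \<in> (adj F)\<^sup>*)"

text \<open>Edges as well as vertices are distinct, since one further edge has to turn the path into
  a \<open>cycle_seq\<close>.\<close>

definition simple_path :: "'a set set \<Rightarrow> 'a \<Rightarrow> 'a \<Rightarrow> 'a list \<Rightarrow> 'a set list \<Rightarrow> bool" where
  "simple_path F u w vs es \<longleftrightarrow>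
    length vs = Suc (length es) \<and> vs ! 0 = u \<and> vs ! length es = w \<and> distinct vs \<and> distinct es \<and>
    set es \<subseteq> F \<and> (\<forall>i<length es. vs ! i \<in> es ! i \<and> vs ! Suc i \<in> es ! i)"

text \<open>The path is extended along the chain of adjacencies. If the next vertex is already on
  it, it is cut back to that vertex; if only the next edge is, it is cut back to that edge.\<close>

lemma simple_path_exists:
  assumes "(u, w) \<in> (adj F)\<^sup>*"
  shows "\<exists>vs es. simple_path F u w vs es"
  using assms
proof (induction rule: rtrancl_induct)
  case base
  have "simple_path F u u [u] []" by (simp add: simple_path_def)
  then show ?case by blast
next
  case (step y z)
  then obtain vs es where p: "simple_path F u y vs es" by blast
  from step obtain f where f: "f \<in> F" "y \<in> f" "z \<in> f" by blast
  show ?case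
  proof (cases "z \<in> set vs")
    case True
    then obtain q where q: "q < length vs" "vs ! q = z" by (auto simp: in_set_conv_nth)
    then have "simple_path F u z (take (Suc q) vs) (take q es)"
      using p set_take_subset[of q es] by (auto simp: simple_path_def)
    then show ?thesis by blast
  next
    case z: False
    show ?thesis
    proof (cases "f \<in> set es")
      case True
      then obtain q where q: "q < length es" "es ! q = f" by (auto simp: in_set_conv_nth)
      \<comment> \<open>The repeated edge \<open>f\<close> becomes the last one: it is entered at
        \<open>vs ! q\<close> as before and left directly for \<open>z\<close>.\<close>
      have "simple_path F u z (take (Suc q) vs @ [z]) (take (Suc q) es)"
        using p q z f set_take_subset[of "Suc q" es] set_take_subset[of "Suc q" vs]
          min_absorb2[OF Suc_leI[OF q(1)]]
        by (auto simp: simple_path_def nth_append less_Suc_eq)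
      then show ?thesis by blast
    next
      case False
      have "simple_path F u z (vs @ [z]) (es @ [f])"
        using p z f False by (auto simp: simple_path_def nth_append less_Suc_eq)
      then show ?thesis by blast
    qed
  qed
qed

text \<open>A path inside \<open>F\<close> is closed up by \<open>e\<close>. The vertices incident
  with \<open>e\<close> are recorded because they distinguish cycles that pass through
  \<open>e\<close> at different pairs.\<close>

lemma cycle_through_edge:
  assumes "hypergraph H" "F \<subseteq> edges H" "e \<in> edges H - F" "u \<in> e" "w \<in> e" "u \<noteq> w"
    and "(u, w) \<in> (adj F)\<^sup>*"
  shows "\<exists>vs es. cycle_seq H vs es \<and> set es \<subseteq> insert e F \<and> {v. (v, e) \<in> incidences vs es} = {u, w}"
proof -
  obtain vs es where p: "simple_path F u w vs es" using simple_path_exists[OF assms(7)] by blast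
  let ?n = "length es"
  have len: "length vs = Suc ?n" and ends: "vs ! 0 = u" "vs ! ?n = w" and es: "set es \<subseteq> F"
    and dist: "distinct vs" "distinct es"
    and inc: "\<And>i. i < ?n \<Longrightarrow> vs ! i \<in> es ! i \<and> vs ! Suc i \<in> es ! i"
    using p by (auto simp: simple_path_def)
  have n0: "Suc 0 \<le> ?n" using ends assms(6) by (cases ?n) auto
  have inc': "vs ! i \<in> (es @ [e]) ! i \<and> vs ! (Suc i mod length vs) \<in> (es @ [e]) ! i" if "i < length vs" for i
    using that inc[of i] ends assms(4,5) len by (cases "i = ?n") (auto simp: nth_append)
  have E: "set (es @ [e]) \<subseteq> edges H" using es assms by auto
  have "set vs \<subseteq> verts H"
  proof
    fix v assume "v \<in> set vs"
    then obtain i where i: "i < length vs" "vs ! i = v" by (auto simp: in_set_conv_nth)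
    then have "v \<in> (es @ [e]) ! i" "(es @ [e]) ! i \<in> set (es @ [e])"
      using inc'[of i] len nth_mem[of i "es @ [e]"] by auto
    then show "v \<in> verts H" using E assms(1) unfolding hypergraph_def by blast
  qed
  then have cyc: "cycle_seq H vs (es @ [e])"
    unfolding cycle_seq_def using len n0 dist es assms(3) E inc' by auto
  have eq: "(es @ [e]) ! i = e \<longleftrightarrow> i = ?n" if "i < length vs" for i
  proof (cases "i < ?n")
    case True
    then have "es ! i \<in> F" using es nth_mem by blast
    then show ?thesis using True assms(3) by (auto simp: nth_append)
  qed (use that len in \<open>auto simp: nth_append\<close>)
  have "(v, e) \<in> incidences vs (es @ [e]) \<longleftrightarrow> v = u \<or> v = w" for v
  proof -
    have "(v, e) \<in> incidences vs (es @ [e]) \<longleftrightarrow>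
      (\<exists>i<length vs. (es @ [e]) ! i = e \<and> (v = vs ! i \<or> v = vs ! (Suc i mod length vs)))"
      unfolding incidences_def by auto
    also have "\<dots> \<longleftrightarrow> (\<exists>i<length vs. i = ?n \<and> (v = vs ! i \<or> v = vs ! (Suc i mod length vs)))"
      using eq by blast
    finally show ?thesis using ends len by auto
  qed
  then have "{v. (v, e) \<in> incidences vs (es @ [e])} = {u, w}" by auto
  moreover have "set (es @ [e]) \<subseteq> insert e F" using es by auto
  ultimately show ?thesis using cyc by metis
qed

text \<open>A vertex of the cycle lies in two cyclically consecutive edges: besides
  \<open>es ! i\<close>, in the preceding one if it is \<open>vs ! i\<close>, otherwise in the
  following one.\<close>

lemma cycle_seq_other_edge:
  assumes "cycle_seq H vs es" "i < length vs" "v = vs ! i \<or> v = vs ! (Suc i mod length vs)"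
  obtains f where "f \<in> set es" "f \<noteq> es ! i" "v \<in> f"
proof -
  let ?n = "length vs"
  have n: "2 \<le> ?n" "length es = ?n" "distinct es"
    and inc: "\<And>i. i < ?n \<Longrightarrow> vs ! i \<in> es ! i \<and> vs ! (Suc i mod ?n) \<in> es ! i"
    using assms(1) by (auto simp: cycle_seq_def)
  have "\<exists>p<?n. p \<noteq> i \<and> v \<in> es ! p"
  proof (cases "v = vs ! i")
    case True
    show ?thesis
    proof (cases i)
      case 0
      moreover have "Suc (?n - 1) = ?n" "?n - 1 < ?n" "?n - 1 \<noteq> 0" using n by linarith+
      moreover from this(1) have "Suc (?n - 1) mod ?n = 0" by simp
      ultimately show ?thesis using inc[of "?n - 1"] True by metis
    next
      case (Suc p)
      then show ?thesis using inc[of p] assms(2) True by (intro exI[of _ p]) auto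
    qed
  next
    case False
    then have "v = vs ! (Suc i mod ?n)" using assms(3) by simp
    moreover have "Suc i mod ?n < ?n" "Suc i mod ?n \<noteq> i"
      using n assms(2) by (auto simp: mod_Suc)
    ultimately show ?thesis using inc[of "Suc i mod ?n"] by blast
  qed
  then show thesis using that n assms(2) nth_eq_iff_index_eq[OF n(3)] nth_mem by metis
qed

lemma cycle_seq_consecutive:
  assumes "cycle_seq H vs es" "i < length vs"
  shows "Suc i mod length vs < length vs" "vs ! i \<noteq> vs ! (Suc i mod length vs)"
    "vs ! i \<in> es ! i" "vs ! (Suc i mod length vs) \<in> es ! i" "es ! i \<in> set es"
proof -
  have n: "2 \<le> length vs" "length es = length vs" "distinct vs" using assms(1) by (auto simp: cycle_seq_def)
  then have "Suc i mod length vs \<noteq> i" using assms(2) by (auto simp: mod_Suc)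
  moreover show l: "Suc i mod length vs < length vs" using assms(2) by (intro mod_less_divisor) linarith
  ultimately show "vs ! i \<noteq> vs ! (Suc i mod length vs)"
    using n assms(2) nth_eq_iff_index_eq[OF n(3)] by metis
  show "vs ! i \<in> es ! i" "vs ! (Suc i mod length vs) \<in> es ! i" "es ! i \<in> set es"
    using assms n by (auto simp: cycle_seq_def)
qed

lemma cycle_seq_edge:
  assumes "cycle_seq H vs es" "e \<in> set es"
  obtains u w where "u \<noteq> w" "u \<in> e" "w \<in> e" "\<exists>f\<in>set es. f \<noteq> e \<and> u \<in> f" "\<exists>f\<in>set es. f \<noteq> e \<and> w \<in> f"
proof -
  have "length es = length vs" using assms by (simp add: cycle_seq_def)
  then obtain i where i: "i < length vs" "es ! i = e" using assms(2) by (auto simp: in_set_conv_nth)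
  note c = cycle_seq_consecutive[OF assms(1) i(1)]
  show thesis
    using that[OF c(2)] c(3,4) cycle_seq_other_edge[OF assms(1) i(1)] i(2) by metis
qed

text \<open>These are cycles of \<open>H\<close> itself that use only edges of \<open>F\<close>, so
  that uniqueness of the cycle of \<open>H\<close> applies to them without transfer.\<close>

definition has_cycle :: "'a hypergraph \<Rightarrow> 'a set set \<Rightarrow> bool" where
  "has_cycle H F \<longleftrightarrow> (\<exists>vs es. cycle_seq H vs es \<and> set es \<subseteq> F)"

lemma has_cycle_mono: "has_cycle H F \<Longrightarrow> F \<subseteq> G \<Longrightarrow> has_cycle H G"
  unfolding has_cycle_def by blast

text \<open>An edge of a cycle shares two vertices with the other edges of that cycle, so an edge
  attached in at most one vertex lies on none.\<close>

lemma has_cycle_insertD: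
  assumes "has_cycle H (insert e F)" "card (e \<inter> \<Union>F) \<le> 1" "finite e"
  shows "has_cycle H F"
proof -
  from assms(1) obtain vs es where c: "cycle_seq H vs es" "set es \<subseteq> insert e F"
    by (auto simp: has_cycle_def)
  have "e \<notin> set es"
  proof
    assume "e \<in> set es"
    then obtain u w where "u \<noteq> w" "u \<in> e" "w \<in> e" "\<exists>f\<in>set es. f \<noteq> e \<and> u \<in> f"
      "\<exists>f\<in>set es. f \<noteq> e \<and> w \<in> f" by (rule cycle_seq_edge[OF c(1)])
    then have "{u, w} \<subseteq> e \<inter> \<Union>F" "card {u, w} = 2" using c(2) by auto
    then show False using card_mono[of "e \<inter> \<Union>F" "{u, w}"] assms(2,3) by simp
  qed
  then show ?thesis using c by (auto simp: has_cycle_def)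
qed

lemma incidences_edge: "cycle_seq H vs es \<Longrightarrow> (v, e) \<in> incidences vs es \<Longrightarrow> e \<in> set es"
  by (auto simp: incidences_def cycle_seq_def)

lemma connected_edges_insert:
  assumes "connected_edges F" "x \<in> e" "x \<in> \<Union>F"
  shows "connected_edges (insert e F)"
proof -
  let ?R = "(adj (insert e F))\<^sup>*"
  have sym: "sym ?R" by (rule sym_rtrancl) (auto intro: symI)
  have x: "(x, v) \<in> ?R" if "v \<in> \<Union>(insert e F)" for v
  proof (cases "v \<in> e")
    case True
    then show ?thesis using assms(2) by blast
  next
    case False
    then have "(x, v) \<in> (adj F)\<^sup>*" using that assms unfolding connected_edges_def by blast
    moreover have "(adj F)\<^sup>* \<subseteq> ?R" by (rule rtrancl_mono) auto
    ultimately show ?thesis by blast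
  qed
  show ?thesis unfolding connected_edges_def
    using x sym by (meson rtrancl_trans symD)
qed

lemma connected_closed:
  assumes "connected_hg H" "x \<in> S" "x \<in> verts H" "y \<in> verts H"
    and "\<And>e. e \<in> edges H \<Longrightarrow> e \<inter> S \<noteq> {} \<Longrightarrow> e \<subseteq> S"
  shows "y \<in> S"
proof -
  have "(x, y) \<in> (adj (edges H))\<^sup>*" using assms(1,3,4) by (simp add: connected_hg_def)
  then show ?thesis by (induction rule: rtrancl_induct) (use assms(2,5) in blast)+
qed

lemma unicyclic_incidences_eq:
  assumes "unicyclic H" "cycle_seq H vs es" "cycle_seq H vs' es'"
  shows "incidences vs es = incidences vs' es'"
  using assms unfolding unicyclic_def cycles_def by blast

lemma unicyclic_cycle_seq:
  assumes "unicyclic H"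
  obtains vs es where "cycle_seq H vs es"
  using assms unfolding unicyclic_def cycles_def by blast

lemma hypergraph_finite_edges: "hypergraph H \<Longrightarrow> finite (edges H)"
  unfolding hypergraph_def by (meson Pow_iff finite_Pow_iff finite_subset subsetI)

text \<open>
  Each new edge attaches to a connected edge set in one vertex, except for the edge that closes
  the cycle, which attaches in two.
\<close>

lemma growth_step:
  assumes H: "hypergraph H" "uniform k H" "2 \<le> k" "unicyclic H"
    and F: "F \<subseteq> edges H" "connected_edges F" and e: "e \<in> edges H - F" "e \<inter> \<Union>F \<noteq> {}"
  shows "card (e \<inter> \<Union>F) + of_bool (has_cycle H F) = 1 + of_bool (has_cycle H (insert e F))"
proof -
  let ?S = "e \<inter> \<Union>F"
  have fin: "finite e" using H e by (auto simp: hypergraph_def finite_subset)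
  have cyc: "\<exists>vs es. cycle_seq H vs es \<and> set es \<subseteq> insert e F \<and> {v. (v, e) \<in> incidences vs es} = {u, w}"
    if "u \<in> ?S" "w \<in> ?S" "u \<noteq> w" for u w
    using that F(2) by (intro cycle_through_edge[OF H(1) F(1) e(1)]) (auto simp: connected_edges_def)
  have ge1: "card ?S \<ge> 1" using fin e(2) by (simp add: Suc_leI card_gt_0_iff)
  \<comment> \<open>Three attachment vertices would give two cycles that use \<open>e\<close> at
    different pairs.\<close>
  have le2: "card ?S \<le> 2"
  proof (rule ccontr)
    assume "\<not> ?thesis"
    then have "3 \<le> card ?S" by simp
    then obtain T where "T \<subseteq> ?S" "card T = 3" by (meson obtain_subset_with_card_n)
    then obtain u w x where "{u, w, x} \<subseteq> ?S" "u \<noteq> w" "u \<noteq> x" "w \<noteq> x"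
      by (metis card_3_iff)
    then have "u \<in> ?S" "w \<in> ?S" "x \<in> ?S" "u \<noteq> w" "u \<noteq> x" "w \<noteq> x" by blast+
    note u = this
    obtain vs es where c: "cycle_seq H vs es" "{v. (v, e) \<in> incidences vs es} = {u, w}"
      using cyc[OF u(1,2,4)] by blast
    obtain vs' es' where c': "cycle_seq H vs' es'" "{v. (v, e) \<in> incidences vs' es'} = {u, x}"
      using cyc[OF u(1,3,5)] by blast
    have "{u, w} = {u, x}"
      unfolding c(2)[symmetric] c'(2)[symmetric] unicyclic_incidences_eq[OF H(4) c(1) c'(1)] ..
    with u show False by (auto simp: doubleton_eq_iff)
  qed
  \<comment> \<open>The cycle closed by \<open>e\<close> is the only one, and it is not contained in
    \<open>F\<close>, which lacks \<open>e\<close>.\<close>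
  have two: "has_cycle H (insert e F) \<and> \<not> has_cycle H F" if "card ?S = 2"
  proof -
    from that obtain u w where uw: "?S = {u, w}" "u \<noteq> w" by (auto simp: card_2_iff)
    then have "u \<in> ?S" "w \<in> ?S" by blast+
    from cyc[OF this uw(2)] obtain vs es where c: "cycle_seq H vs es" "set es \<subseteq> insert e F"
      "{v. (v, e) \<in> incidences vs es} = {u, w}" by blast
    have "\<not> has_cycle H F"
    proof
      assume "has_cycle H F"
      then obtain vs' es' where c': "cycle_seq H vs' es'" "set es' \<subseteq> F" by (auto simp: has_cycle_def)
      have "(u, e) \<in> incidences vs' es'"
        using c(3) unicyclic_incidences_eq[OF H(4) c(1) c'(1)] by blast
      then show False using incidences_edge[OF c'(1)] c'(2) e(1) by blast
    qed
    then show ?thesis using c by (auto simp: has_cycle_def)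
  qed
  show ?thesis
  proof (cases "card ?S = 2")
    case False
    then have "card ?S = 1" using ge1 le2 by linarith
    then show ?thesis using has_cycle_insertD[of H e F] has_cycle_mono[of H F "insert e F"] fin by auto
  qed (use two in auto)
qed

text \<open>A new edge brings \<open>k - 1\<close> new vertices, or \<open>k - 2\<close> when it
  closes the cycle; \<open>of_bool\<close> makes up for the missing one. Connectedness is carried
  along because \<open>growth_step\<close> needs it.\<close>

lemma connected_subset_grows:
  assumes H: "hypergraph H" "uniform k H" "2 \<le> k" "unicyclic H" and n: "Suc n \<le> card (edges H)"
  shows "\<exists>F\<subseteq>edges H. card F = Suc n \<and> connected_edges F \<and>
    card (\<Union>F) + of_bool (has_cycle H F) = Suc n * (k - 1) + 1"
  using n
proof (induction n)
  case 0
  then obtain e where e: "e \<in> edges H" by (cases "edges H = {}") auto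
  have "\<not> has_cycle H {e}"
  proof
    assume "has_cycle H {e}"
    then obtain vs es where "cycle_seq H vs es" "set es \<subseteq> {e}" by (auto simp: has_cycle_def)
    then have "2 \<le> card (set es)" by (auto simp: cycle_seq_def distinct_card)
    moreover have "card (set es) \<le> card {e}" using \<open>set es \<subseteq> {e}\<close> by (intro card_mono) auto
    ultimately show False by simp
  qed
  moreover have "card e = k" using e H by (auto simp: uniform_def)
  moreover have "connected_edges {e}" by (auto simp: connected_edges_def)
  ultimately show ?case using e H(3) by (intro exI[of _ "{e}"]) auto
next
  case (Suc n)
  then obtain F where F: "F \<subseteq> edges H" "card F = Suc n" "connected_edges F"
    "card (\<Union>F) + of_bool (has_cycle H F) = Suc n * (k - 1) + 1" by auto
  have ne: "f \<noteq> {}" if "f \<in> edges H" for f using that H by (auto simp: uniform_def)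
  have sub: "f \<subseteq> verts H" if "f \<in> edges H" for f using that H by (auto simp: hypergraph_def)
  have finF: "finite F" using F(1) hypergraph_finite_edges[OF H(1)] finite_subset by blast
  have "F \<noteq> {}" using F(2) by auto
  then obtain f x where f: "f \<in> F" "x \<in> f" using ne F(1) by blast
  have "F \<noteq> edges H" using F(2) Suc.prems by auto
  then obtain g y where g: "g \<in> edges H - F" "y \<in> g" using ne F(1) by blast
  have "\<exists>e\<in>edges H - F. e \<inter> \<Union>F \<noteq> {}"
  proof (rule ccontr)
    assume c: "\<not> ?thesis"
    have "y \<in> \<Union>F"
    proof (rule connected_closed[of H x])
      show "connected_hg H" using H(4) by (simp add: unicyclic_def)
      show "e \<subseteq> \<Union>F" if "e \<in> edges H" "e \<inter> \<Union>F \<noteq> {}" for e using c that by blast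
    qed (use f g sub F(1) in blast)+
    then show False using c g by blast
  qed
  then obtain e where e: "e \<in> edges H - F" "e \<inter> \<Union>F \<noteq> {}" by blast
  have fine: "finite e" using H e by (auto simp: hypergraph_def finite_subset)
  have finU: "finite (\<Union>F)"
    using F(1) sub H(1) unfolding hypergraph_def by (meson Sup_least finite_subset subsetD)
  have "card (\<Union>(insert e F)) + card (e \<inter> \<Union>F) = k + card (\<Union>F)"
    using card_Un_Int[OF fine finU] e H(2) by (auto simp: uniform_def)
  moreover have "card (e \<inter> \<Union>F) + of_bool (has_cycle H F) = 1 + of_bool (has_cycle H (insert e F))"
    using growth_step[OF H F(1,3) e] .
  ultimately have "card (\<Union>(insert e F)) + of_bool (has_cycle H (insert e F)) = Suc (Suc n) * (k - 1) + 1"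
    using F(4) H(3) by simp
  moreover have "connected_edges (insert e F)" using e(2) connected_edges_insert[OF F(3)] by blast
  moreover have "card (insert e F) = Suc (Suc n)" using finF F(2) e(1) by simp
  moreover have "insert e F \<subseteq> edges H" using e F by blast
  ultimately show ?case by blast
qed

lemma verts_eq_Union_edges:
  assumes "hypergraph H" "uniform k H" "2 \<le> k" "connected_hg H" "edges H \<noteq> {}"
  shows "verts H = \<Union>(edges H)"
proof
  show "verts H \<subseteq> \<Union>(edges H)"
  proof
    fix v assume v: "v \<in> verts H"
    from assms(5) obtain e where e: "e \<in> edges H" by blast
    then have "e \<noteq> {}" "e \<subseteq> verts H" using assms(1-3) by (auto simp: hypergraph_def uniform_def)
    then obtain x where "x \<in> e" "x \<in> verts H" by blast
    then show "v \<in> \<Union>(edges H)" using connected_closed[OF assms(4), of x "\<Union>(edges H)" v] v e by blast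
  qed
  show "\<Union>(edges H) \<subseteq> verts H" using assms(1) by (auto simp: hypergraph_def)
qed

text \<open>Grown to all edges, the set contains the cycle, so the count is one below the value m (k
  - 1) + 1 of a hypertree.\<close>

lemma unicyclic_card_verts:
  assumes H: "hypergraph H" "uniform k H" "2 \<le> k" "unicyclic H"
  shows "verts H = \<Union>(edges H)" "card (verts H) = card (edges H) * (k - 1)"
proof -
  obtain vs es where c: "cycle_seq H vs es" using unicyclic_cycle_seq[OF H(4)] .
  then have "edges H \<noteq> {}" by (auto simp: cycle_seq_def)
  then show V: "verts H = \<Union>(edges H)"
    using verts_eq_Union_edges[OF H(1-3)] H(4) by (auto simp: unicyclic_def)
  have "card (edges H) > 0"
    using \<open>edges H \<noteq> {}\<close> hypergraph_finite_edges[OF H(1)] by (simp add: card_gt_0_iff)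
  then obtain n where n: "card (edges H) = Suc n" by (cases "card (edges H)") auto
  from connected_subset_grows[OF H, of n] n obtain F where F: "F \<subseteq> edges H" "card F = Suc n"
    "card (\<Union>F) + of_bool (has_cycle H F) = Suc n * (k - 1) + 1" by auto
  have "F = edges H" using F n hypergraph_finite_edges[OF H(1)] by (intro card_subset_eq) auto
  moreover have "has_cycle H (edges H)" using c by (auto simp: has_cycle_def cycle_seq_def)
  ultimately show "card (verts H) = card (edges H) * (k - 1)" using F(3) n V by simp
qed

section \<open>Degree sums and vertices on cycles\<close>

lemma sum_degree:
  assumes "hypergraph H" "uniform k H"
  shows "(\<Sum>v\<in>verts H. degree H v) = card (edges H) * k"
proof -
  note fin = hypergraph_finite_edges[OF assms(1)]
  have V: "finite (verts H)" using assms by (simp add: hypergraph_def)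
  have "(\<Sum>v\<in>verts H. degree H v) = (\<Sum>v\<in>verts H. \<Sum>e\<in>edges H. if v \<in> e then 1 else 0)"
    using fin by (simp add: degree_def sum.If_cases Int_def)
  also have "\<dots> = (\<Sum>e\<in>edges H. \<Sum>v\<in>verts H. if v \<in> e then 1 else 0)" by (rule sum.swap)
  also have "\<dots> = (\<Sum>e\<in>edges H. k)"
  proof (rule sum.cong[OF refl])
    fix e assume e: "e \<in> edges H"
    then have "verts H \<inter> e = e" using assms(1) by (auto simp: hypergraph_def)
    then show "(\<Sum>v\<in>verts H. if v \<in> e then 1 else 0) = k"
      using V e assms(2) by (simp add: sum.If_cases uniform_def)
  qed
  finally show ?thesis by simp
qed

lemma degree_ge_2:
  assumes "finite (edges H)" "e \<in> edges H" "f \<in> edges H" "e \<noteq> f" "v \<in> e" "v \<in> f"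
  shows "2 \<le> degree H v"
proof -
  have "card {e, f} \<le> card {e \<in> edges H. v \<in> e}" using assms by (intro card_mono) auto
  then show ?thesis using assms(4) by (simp add: degree_def)
qed

lemma linear_hg_unique:
  assumes "linear_hg H" "finite e" "e \<in> edges H" "f \<in> edges H" "e \<noteq> f" "x \<in> e" "x \<in> f" "y \<in> e" "y \<in> f"
  shows "x = y"
proof -
  have "card (e \<inter> f) \<le> 1" using assms by (auto simp: linear_hg_def)
  then show ?thesis using assms card_le_Suc0_iff_eq[of "e \<inter> f"] by auto
qed

text \<open>A cycle of length two would consist of two edges with two common vertices.\<close>

lemma linear_cycle_length:
  assumes "linear_hg H" "hypergraph H" "cycle_seq H vs es"
  shows "3 \<le> length vs"
proof (rule ccontr)
  assume "\<not> ?thesis"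
  then have l: "length vs = 2" "length es = 2" using assms(3) by (auto simp: cycle_seq_def)
  have "es ! 0 \<in> set es" "es ! 1 \<in> set es" using l by (auto intro: nth_mem)
  then have E: "es ! 0 \<in> edges H" "es ! 1 \<in> edges H" using assms(3) by (auto simp: cycle_seq_def)
  have "vs ! 0 \<noteq> vs ! 1" "es ! 0 \<noteq> es ! 1"
    using assms(3) l by (auto simp: cycle_seq_def nth_eq_iff_index_eq)
  moreover have "vs ! 0 \<in> es ! 0" "vs ! 1 \<in> es ! 0" "vs ! 0 \<in> es ! 1" "vs ! 1 \<in> es ! 1"
    using assms(3) l cycle_seq_consecutive[OF assms(3), of 0] cycle_seq_consecutive[OF assms(3), of 1]
    by (auto simp: numeral_2_eq_2)
  moreover have "finite (es ! 0)" using E assms(2) by (auto simp: hypergraph_def finite_subset)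
  ultimately show False using linear_hg_unique[OF assms(1) _ E] by blast
qed

lemma cycle_vertex_degree:
  assumes "hypergraph H" "cycle_seq H vs es" "v \<in> set vs"
  shows "v \<in> verts H \<and> 2 \<le> degree H v"
proof -
  obtain i where i: "i < length vs" "vs ! i = v" using assms(3) by (auto simp: in_set_conv_nth)
  obtain f where f: "f \<in> set es" "f \<noteq> es ! i" "v \<in> f"
    using cycle_seq_other_edge[OF assms(2) i(1), of v] i(2) by blast
  have "set es \<subseteq> edges H" "set vs \<subseteq> verts H" using assms(2) by (auto simp: cycle_seq_def)
  then show ?thesis
    using f assms(3) degree_ge_2[OF hypergraph_finite_edges[OF assms(1)], of "es ! i" f v]
      cycle_seq_consecutive[OF assms(2) i(1)] i(2) by blast
qed

section \<open>Degrees\<close>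

lemma linear_unicyclicD:
  assumes "linear_unicyclic k m H" "2 \<le> k"
  shows "hypergraph H" "uniform k H" "linear_hg H" "unicyclic H" "card (edges H) = m"
    "finite (edges H)" "finite (verts H)" "verts H = \<Union>(edges H)" "card (verts H) = m * (k - 1)"
    "\<And>v. v \<in> verts H \<Longrightarrow> 1 \<le> degree H v" "\<And>e. e \<in> edges H \<Longrightarrow> finite e"
proof -
  show H: "hypergraph H" "uniform k H" "linear_hg H" "unicyclic H" "card (edges H) = m"
    using assms by (auto simp: linear_unicyclic_def)
  show fin: "finite (edges H)" "finite (verts H)"
    using hypergraph_finite_edges[OF H(1)] H(1) by (auto simp: hypergraph_def)
  show V: "verts H = \<Union>(edges H)" "card (verts H) = m * (k - 1)"
    using unicyclic_card_verts[OF H(1,2) assms(2) H(4)] H(5) by auto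
  show "1 \<le> degree H v" if "v \<in> verts H" for v
    using that fin unfolding degree_def V(1) by (auto simp: Suc_le_eq card_gt_0_iff)
  show "finite e" if "e \<in> edges H" for e using that H(1) by (auto simp: hypergraph_def finite_subset)
qed

lemma card_degree_ge_2:
  assumes "linear_unicyclic k m H" "2 \<le> k"
  shows "3 \<le> card {v \<in> verts H. 2 \<le> degree H v}"
proof -
  note H = linear_unicyclicD[OF assms]
  obtain vs es where c: "cycle_seq H vs es" using unicyclic_cycle_seq[OF H(4)] .
  have "3 \<le> card (set vs)"
    using linear_cycle_length[OF H(3,1) c] c by (simp add: cycle_seq_def distinct_card)
  also have "\<dots> \<le> card {v \<in> verts H. 2 \<le> degree H v}"
    using cycle_vertex_degree[OF H(1) c] H(7) by (intro card_mono) auto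
  finally show ?thesis .
qed

text \<open>Sum of d^2 + 2 = (d - 1)(d - 2) + 3 d, which holds in the naturals because
  \<open>d \<ge> 1\<close>. Constants are added on both sides rather than subtracted, to avoid
  truncation.\<close>

lemma sum_degree_squares:
  assumes "linear_unicyclic k m H" "2 \<le> k"
  shows "(\<Sum>v\<in>verts H. (degree H v)\<^sup>2) + 2 * (m * (k - 1)) =
      (\<Sum>v\<in>verts H. (degree H v - 1) * (degree H v - 2)) + 3 * (m * k)"
    and "(\<Sum>v\<in>verts H. degree H v - 1) = m"
proof -
  note H = linear_unicyclicD[OF assms]
  have d: "\<exists>x. degree H v = Suc x" if "v \<in> verts H" for v
    using H(10)[OF that] by (cases "degree H v") auto
  have deg: "(\<Sum>v\<in>verts H. degree H v) = m * k" using sum_degree[OF H(1,2)] H(5) by simp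
  have "(\<Sum>v\<in>verts H. (degree H v)\<^sup>2) + 2 * (m * (k - 1)) = (\<Sum>v\<in>verts H. (degree H v)\<^sup>2 + 2)"
    using H(9) by (simp add: sum.distrib del: add_2_eq_Suc add_2_eq_Suc')
  also have "\<dots> = (\<Sum>v\<in>verts H. (degree H v - 1) * (degree H v - 2) + 3 * degree H v)"
  proof (rule sum.cong[OF refl])
    fix v assume "v \<in> verts H"
    from d[OF this] obtain x where x: "degree H v = Suc x" by blast
    show "(degree H v)\<^sup>2 + 2 = (degree H v - 1) * (degree H v - 2) + 3 * degree H v"
      unfolding x by (cases x) (auto simp: power2_eq_square algebra_simps)
  qed
  also have "\<dots> = (\<Sum>v\<in>verts H. (degree H v - 1) * (degree H v - 2)) + 3 * (m * k)"
    by (simp add: sum.distrib deg sum_distrib_left[symmetric])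
  finally show "(\<Sum>v\<in>verts H. (degree H v)\<^sup>2) + 2 * (m * (k - 1)) =
      (\<Sum>v\<in>verts H. (degree H v - 1) * (degree H v - 2)) + 3 * (m * k)" .
  have "(\<Sum>v\<in>verts H. degree H v - 1) + m * (k - 1) = (\<Sum>v\<in>verts H. (degree H v - 1) + 1)"
    unfolding sum.distrib using H(9) by simp
  also have "\<dots> = (\<Sum>v\<in>verts H. degree H v)" by (rule sum.cong) (use d in force)+
  also have "\<dots> = m + m * (k - 1)" using deg assms(2) by (cases k) auto
  finally show "(\<Sum>v\<in>verts H. degree H v - 1) = m" by simp
qed

text \<open>In \<open>G\<close> the factor d - 1 is at most m - 3, and the values d - 2 over the
  vertices of degree at least two sum up to \<open>m - card ?S\<close>, again at most m - 3. In
  \<open>H\<close> the vertex \<open>c\<close> alone exceeds the product.\<close>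

lemma sum_degree_squares_less:
  assumes G: "linear_unicyclic k m G" and H: "linear_unicyclic k m H" and k: "2 \<le> k" "3 \<le> m"
    and small: "\<And>v. v \<in> verts G \<Longrightarrow> degree G v < m - 1"
    and large: "c \<in> verts H" "degree H c = m - 1"
  shows "(\<Sum>v\<in>verts G. (degree G v)\<^sup>2) < (\<Sum>v\<in>verts H. (degree H v)\<^sup>2)"
proof -
  note GD = linear_unicyclicD[OF G k(1)] and HD = linear_unicyclicD[OF H k(1)]
  let ?S = "{v \<in> verts G. 2 \<le> degree G v}"
  have S: "3 \<le> card ?S" by (rule card_degree_ge_2[OF G k(1)])
  then have "?S \<noteq> {}" by (metis card.empty not_numeral_le_zero)
  \<comment> \<open>Some degree lies between 2 and m - 2. The factor m - 3 is therefore positive, as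
    the strict step below requires.\<close>
  then have m: "4 \<le> m" using small by fastforce
  \<comment> \<open>Truncated subtraction makes d - 2 one less than d - 1 exactly at the vertices of
    \<open>?S\<close>; at degree 1 both vanish.\<close>
  have "(\<Sum>v\<in>verts G. degree G v - 2) + card ?S = (\<Sum>v\<in>verts G. (degree G v - 2) + of_bool (2 \<le> degree G v))"
    using GD(7) by (simp add: sum.distrib Int_def)
  also have "\<dots> = (\<Sum>v\<in>verts G. degree G v - 1)" by (rule sum.cong) auto
  finally have two: "(\<Sum>v\<in>verts G. degree G v - 2) + card ?S = m"
    using sum_degree_squares(2)[OF G k(1)] by simp
  have "(\<Sum>v\<in>verts G. (degree G v - 1) * (degree G v - 2)) \<le> (\<Sum>v\<in>verts G. (m - 3) * (degree G v - 2))"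
    using small by (intro sum_mono mult_right_mono) fastforce+
  also have "\<dots> \<le> (m - 3) * (m - 3)"
    unfolding sum_distrib_left[symmetric] using two S by (intro mult_left_mono) auto
  also have "\<dots> < (m - 2) * (m - 3)" using m by (intro mult_strict_right_mono) auto
  also have "\<dots> = (degree H c - 1) * (degree H c - 2)"
    using large(2) by (simp add: numeral_2_eq_2 numeral_3_eq_3)
  also have "\<dots> \<le> (\<Sum>v\<in>verts H. (degree H v - 1) * (degree H v - 2))"
    by (rule member_le_sum[OF large(1)]) (use HD in auto)
  finally show ?thesis
    using sum_degree_squares(1)[OF G k(1)] sum_degree_squares(1)[OF H k(1)] by linarith
qed

section \<open>Hypergraphs with a vertex on all edges but one\<close>

text \<open>
  An intrinsic form of \<open>C\<^sub>3 \<odot> S\<^sub>m\<^sub>-\<^sub>3\<close>: the pendant edges sit at \<open>c\<close>, and \<open>e0\<close>, \<open>e1\<close>, \<open>e2\<close> are the edges of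
  the triangle opposite to \<open>c\<close>, \<open>b\<close>, \<open>a\<close>.
\<close>

definition triangle_star ::
    "nat \<Rightarrow> nat \<Rightarrow> 'a hypergraph \<Rightarrow> 'a \<Rightarrow> 'a \<Rightarrow> 'a \<Rightarrow> 'a set \<Rightarrow> 'a set \<Rightarrow> 'a set \<Rightarrow> bool" where
  "triangle_star k m H a b c e0 e1 e2 \<longleftrightarrow>
    verts H = \<Union>(edges H) \<and> finite (edges H) \<and> uniform k H \<and> card (edges H) = m \<and>
    {e0, e1, e2} \<subseteq> edges H \<and> e0 \<noteq> e1 \<and> e0 \<noteq> e2 \<and> e1 \<noteq> e2 \<and>
    c \<notin> e0 \<and> (\<forall>f\<in>edges H - {e0}. c \<in> f) \<and>
    (\<forall>f\<in>edges H - {e0}. \<forall>g\<in>edges H - {e0}. f \<noteq> g \<longrightarrow> f \<inter> g = {c}) \<and>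
    e0 \<inter> e1 = {a} \<and> e0 \<inter> e2 = {b} \<and> (\<forall>f\<in>edges H - {e0, e1, e2}. e0 \<inter> f = {})"

text \<open>Without the common vertex \<open>c\<close> the edges are disjoint and have
  \<open>k - 1\<close> vertices each.\<close>

lemma card_sunflower:
  assumes "finite F" "F \<noteq> {}" "\<And>f. f \<in> F \<Longrightarrow> card f = k \<and> finite f \<and> c \<in> f"
    "\<And>f g. f \<in> F \<Longrightarrow> g \<in> F \<Longrightarrow> f \<noteq> g \<Longrightarrow> f \<inter> g = {c}"
  shows "card (\<Union>F) = card F * (k - 1) + 1"
proof -
  have "\<Union>F = insert c (\<Union>f\<in>F. f - {c})" using assms(2,3) by blast
  moreover have "card (\<Union>f\<in>F. f - {c}) = (\<Sum>f\<in>F. card (f - {c}))"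
  proof (rule card_UN_disjoint[OF assms(1)])
    show "\<forall>f\<in>F. \<forall>g\<in>F. f \<noteq> g \<longrightarrow> (f - {c}) \<inter> (g - {c}) = {}" using assms(4) by blast
  qed (use assms(3) in auto)
  moreover have "(\<Sum>f\<in>F. card (f - {c})) = card F * (k - 1)" using assms(3) by simp
  moreover have "finite (\<Union>f\<in>F. f - {c})" "c \<notin> (\<Union>f\<in>F. f - {c})" using assms(1,3) by auto
  ultimately show ?thesis by (metis Suc_eq_plus1 card_insert_disjoint)
qed

lemma large_degree_triangle_star:
  assumes H: "linear_unicyclic k m H" and k: "2 \<le> k" "3 \<le> m" and c: "c \<in> verts H" "m - 1 \<le> degree H c"
  shows "\<exists>a b e0 e1 e2. triangle_star k m H a b c e0 e1 e2"
proof -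
  note HD = linear_unicyclicD[OF H k(1)]
  let ?F = "{f \<in> edges H. c \<in> f}"
  have cF: "card ?F = degree H c" by (simp add: degree_def)
  have inter: "f \<inter> g = {c}" if "f \<in> ?F" "g \<in> ?F" "f \<noteq> g" for f g
    using that linear_hg_unique[OF HD(3) HD(11)[of f], of g _ c] by blast
  obtain vs es where cyc: "cycle_seq H vs es" using unicyclic_cycle_seq[OF HD(4)] .
  \<comment> \<open>A cycle has a vertex other than \<open>c\<close>, and it lies in two edges; if
    both contained \<open>c\<close>, linearity would fail.\<close>
  have "?F \<noteq> edges H"
  proof
    assume all: "?F = edges H"
    have "0 < length vs" using cyc by (auto simp: cycle_seq_def)
    note cs = cycle_seq_consecutive[OF cyc this]
    obtain v where v: "v \<noteq> c" "v \<in> es ! 0" "v = vs ! 0 \<or> v = vs ! (Suc 0 mod length vs)"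
      using cs by metis
    obtain f where f: "f \<in> set es" "f \<noteq> es ! 0" "v \<in> f"
      using cycle_seq_other_edge[OF cyc \<open>0 < length vs\<close> v(3)] .
    have "set es \<subseteq> ?F" using cyc all by (simp add: cycle_seq_def)
    then show False using inter[of f "es ! 0"] f v cs(5) by blast
  qed
  then obtain e0 where e0: "e0 \<in> edges H" "c \<notin> e0" by blast
  have "card ?F \<le> card (edges H - {e0})" using HD(6) e0 by (intro card_mono) auto
  then have "card ?F = m - 1" using c(2) cF HD(5) e0(1) by simp
  then have F: "?F = edges H - {e0}" using HD(5,6) e0 by (intro card_subset_eq) auto
  have finU: "finite (\<Union>?F)" using HD(6,11) by (intro finite_Union) auto
  have "card (\<Union>?F) = (m - 1) * (k - 1) + 1"
    unfolding \<open>card ?F = m - 1\<close>[symmetric]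
  proof (rule card_sunflower)
    show "?F \<noteq> {}" using c(1) HD(8) by auto
    show "card f = k \<and> finite f \<and> c \<in> f" if "f \<in> ?F" for f
      using that HD(2,11) by (auto simp: uniform_def)
  qed (use HD(6) inter in auto)
  moreover have "verts H = e0 \<union> \<Union>?F" using HD(8) F e0(1) by blast
  then have "card e0 + card (\<Union>?F) = m * (k - 1) + card (e0 \<inter> \<Union>?F)"
    using card_Un_Int[OF HD(11)[OF e0(1)] finU] HD(9) by simp
  moreover have "card e0 = k" using HD(2) e0 by (simp add: uniform_def)
  moreover have "m * (k - 1) = (m - 1) * (k - 1) + (k - 1)" using k by (cases m) auto
  \<comment> \<open>The edges at \<open>c\<close> cover (m - 1)(k - 1) + 1 of the m (k - 1)
    vertices, so just k - 2 vertices of \<open>e0\<close> are new.\<close>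
  ultimately have "card (e0 \<inter> \<Union>?F) = 2" using k by linarith
  then obtain a b where ab: "e0 \<inter> \<Union>?F = {a, b}" "a \<noteq> b" by (auto simp: card_2_iff)
  then have "a \<in> e0 \<inter> \<Union>?F" "b \<in> e0 \<inter> \<Union>?F" by blast+
  then obtain e1 e2 where e: "e1 \<in> ?F" "a \<in> e1" "e2 \<in> ?F" "b \<in> e2" "a \<in> e0" "b \<in> e0" by blast
  have uniq: "x = y" if "f \<in> ?F" "x \<in> e0" "x \<in> f" "y \<in> e0" "y \<in> f" for f x y
    using linear_hg_unique[OF HD(3) HD(11)[OF e0(1)] e0(1), of f x y] e0 that by auto
  have "e1 \<noteq> e2" using uniq[of e1 a b] e ab(2) by blast
  moreover have "e0 \<inter> e1 = {a}" "e0 \<inter> e2 = {b}" using uniq e by blast+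
  \<comment> \<open>A common vertex would be \<open>a\<close> or \<open>b\<close> and thus lie in
    \<open>f\<close> together with \<open>e1\<close> or \<open>e2\<close>; such edges share only
    \<open>c\<close>, which is not in \<open>e0\<close>.\<close>
  moreover have "e0 \<inter> f = {}" if "f \<in> edges H - {e0, e1, e2}" for f
  proof (rule ccontr)
    assume "e0 \<inter> f \<noteq> {}"
    then obtain x where x: "x \<in> e0" "x \<in> f" by blast
    have fF: "f \<in> ?F" "f \<noteq> e1" "f \<noteq> e2" using that F by blast+
    have "x \<in> e0 \<inter> \<Union>?F" using x fF(1) by blast
    then have "x = a \<or> x = b" unfolding ab(1) by simp
    then have "x = c"
      using inter[OF fF(1) e(1) fF(2)] inter[OF fF(1) e(3) fF(3)] x(2) e(2,4) by auto
    then show False using x(1) e0(2) by simp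
  qed
  moreover have "\<forall>f\<in>edges H - {e0}. c \<in> f" unfolding F[symmetric] by simp
  moreover have "\<forall>f\<in>edges H - {e0}. \<forall>g\<in>edges H - {e0}. f \<noteq> g \<longrightarrow> f \<inter> g = {c}"
    unfolding F[symmetric] using inter by blast
  moreover have "{e0, e1, e2} \<subseteq> edges H" "e0 \<noteq> e1" "e0 \<noteq> e2" using e e0 by auto
  ultimately have "triangle_star k m H a b c e0 e1 e2"
    unfolding triangle_star_def using HD(2,5,6,8) e0(2) by metis
  then show ?thesis by metis
qed

text \<open>The last two facts reduce later arguments to the core \<open>{a, b, c}\<close>: they
  give the trace of each edge on it, and any vertex outside it lies in a single edge.\<close>

lemma triangle_starD:
  assumes "triangle_star k m H a b c e0 e1 e2" "2 \<le> k"
  shows "verts H = \<Union>(edges H)" "finite (edges H)" "\<And>e. e \<in> edges H \<Longrightarrow> card e = k \<and> finite e"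
    "card (edges H) = m" "e0 \<in> edges H" "e1 \<in> edges H" "e2 \<in> edges H" "e0 \<noteq> e1" "e0 \<noteq> e2" "e1 \<noteq> e2"
    "a \<noteq> b" "a \<noteq> c" "b \<noteq> c"
    "\<And>f. f \<in> edges H \<Longrightarrow> f \<inter> {a, b, c} =
      (if f = e0 then {a, b} else if f = e1 then {a, c} else if f = e2 then {b, c} else {c})"
    "\<And>f g v. f \<in> edges H \<Longrightarrow> g \<in> edges H \<Longrightarrow> f \<noteq> g \<Longrightarrow> v \<in> f \<Longrightarrow> v \<in> g \<Longrightarrow> v \<in> {a, b, c}"
proof -
  show b: "verts H = \<Union>(edges H)" "finite (edges H)" "card (edges H) = m"
     "e0 \<in> edges H" "e1 \<in> edges H" "e2 \<in> edges H" "e0 \<noteq> e1" "e0 \<noteq> e2" "e1 \<noteq> e2"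
    using assms(1) by (simp_all add: triangle_star_def)
  show "card e = k \<and> finite e" if "e \<in> edges H" for e
    using assms that by (auto simp: triangle_star_def uniform_def intro: card_ge_0_finite)
  have e0: "c \<notin> e0" "e0 \<inter> e1 = {a}" "e0 \<inter> e2 = {b}" "\<And>f. f \<in> edges H \<Longrightarrow> f \<notin> {e0, e1, e2} \<Longrightarrow> e0 \<inter> f = {}"
    and s: "\<And>f. f \<in> edges H \<Longrightarrow> f \<noteq> e0 \<Longrightarrow> c \<in> f"
    "\<And>f g. f \<in> edges H \<Longrightarrow> f \<noteq> e0 \<Longrightarrow> g \<in> edges H \<Longrightarrow> g \<noteq> e0 \<Longrightarrow> f \<noteq> g \<Longrightarrow> f \<inter> g = {c}"
    using assms(1) by (auto simp: triangle_star_def)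
  have e12: "e1 \<inter> e2 = {c}" using s b by blast
  have in_e: "a \<in> e0" "a \<in> e1" "b \<in> e0" "b \<in> e2" using e0(2,3) by auto
  then show ab: "a \<noteq> c" "b \<noteq> c" using e0(1) by auto
  then show "a \<noteq> b" using in_e e12 by auto
  have not_in: "a \<notin> e2" "b \<notin> e1" using in_e e12 ab by auto
  have c_in: "c \<in> e1" "c \<in> e2" using s(1) b by auto
  show "f \<inter> {a, b, c} =
      (if f = e0 then {a, b} else if f = e1 then {a, c} else if f = e2 then {b, c} else {c})"
    if f: "f \<in> edges H" for f
  proof -
    consider "f = e0" | "f = e1" | "f = e2" | "f \<notin> {e0, e1, e2}" by blast
    then show ?thesis
    proof cases
      case 1 then show ?thesis using in_e e0(1) by auto
    next
      case 2 then show ?thesis using in_e not_in b(7,9) c_in by auto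
    next
      case 3 then show ?thesis using in_e not_in b(8,9) c_in by auto
    next
      case 4
      then have "e0 \<inter> f = {}" "c \<in> f" using e0(4) s(1) f by auto
      then show ?thesis using 4 in_e(1,3) by auto
    qed
  qed
  show "v \<in> {a, b, c}" if v: "f \<in> edges H" "g \<in> edges H" "f \<noteq> g" "v \<in> f" "v \<in> g" for f g v
  proof -
    have *: "v \<in> {a, b}" if h: "h \<in> edges H" "h \<noteq> e0" "v \<in> e0" "v \<in> h" for h
    proof -
      have "h = e1 \<or> h = e2" using e0(4)[OF h(1)] h by auto
      then show ?thesis using e0(2,3) h(3,4) by auto
    qed
    consider "f = e0" | "g = e0" | "f \<noteq> e0" "g \<noteq> e0" by blast
    then show ?thesis
    proof cases
      case 1 then show ?thesis using *[of g] v by auto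
    next
      case 2 then show ?thesis using *[of f] v by auto
    next
      case 3 then show ?thesis using s(2)[OF v(1) 3(1) v(2) 3(2) v(3)] v(4,5) by auto
    qed
  qed
qed

section \<open>Triangle stars: the unique cycle, and uniqueness up to isomorphism\<close>

lemma triangle_star_degree:
  assumes "triangle_star k m H a b c e0 e1 e2" "2 \<le> k"
  shows "c \<in> verts H" "degree H c = m - 1"
proof -
  note D = triangle_starD[OF assms]
  have c: "c \<in> f \<longleftrightarrow> f \<noteq> e0" if "f \<in> edges H" for f
  proof -
    have "c \<in> f \<longleftrightarrow> c \<in> f \<inter> {a, b, c}" by simp
    then show ?thesis unfolding D(14)[OF that] using D(12,13) by auto
  qed
  then have "{f \<in> edges H. c \<in> f} = edges H - {e0}" by blast
  then show "degree H c = m - 1" using D(2,4,5) by (simp add: degree_def)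
  show "c \<in> verts H" using c D(1,6,8) by blast
qed

text \<open>An edge of a cycle needs two core vertices, which leaves \<open>e0\<close>,
  \<open>e1\<close>, \<open>e2\<close>. Of these, \<open>a\<close> lies only in \<open>e0\<close>
  and \<open>e1\<close>, and \<open>b\<close> only in \<open>e0\<close> and \<open>e2\<close>, so
  any one of them forces the others into the cycle.\<close>

lemma triangle_star_incidences:
  assumes ts: "triangle_star k m H a b c e0 e1 e2" "2 \<le> k" and cyc: "cycle_seq H vs es"
  shows "incidences vs es = (\<Union>f\<in>{e0, e1, e2}. (f \<inter> {a, b, c}) \<times> {f})"
proof -
  note D = triangle_starD[OF ts]
  let ?S = "{a, b, c}"
  have E: "set es \<subseteq> edges H" and len: "length es = length vs" "2 \<le> length vs"
    using cyc by (auto simp: cycle_seq_def)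
  have core: "v \<in> ?S" if "v \<in> f" "f \<in> set es" "g \<in> set es" "g \<noteq> f" "v \<in> g" for v f g
    using D(15)[of g f v] that E by auto
  have card2: "card (f \<inter> ?S) = (if f \<in> {e0, e1, e2} then 2 else 1)" if "f \<in> edges H" for f
    unfolding D(14)[OF that] using D(11-13) by simp
  have pair: "es ! i \<in> {e0, e1, e2} \<and> es ! i \<inter> ?S = {vs ! i, vs ! (Suc i mod length vs)}"
    if i: "i < length vs" for i
  proof -
    note c = cycle_seq_consecutive[OF cyc i]
    have "vs ! i \<in> ?S" "vs ! (Suc i mod length vs) \<in> ?S"
      using cycle_seq_other_edge[OF cyc i] core c(3-5) by metis+
    then have sub: "{vs ! i, vs ! (Suc i mod length vs)} \<subseteq> es ! i \<inter> ?S" using c(3,4) by simp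
    have c2: "card {vs ! i, vs ! (Suc i mod length vs)} = 2" using c(2) by simp
    have fin: "finite (es ! i \<inter> ?S)" by simp
    have "2 \<le> card (es ! i \<inter> ?S)" using card_mono[OF fin sub] c2 by simp
    moreover have "es ! i \<in> edges H" using c(5) E by blast
    ultimately have e: "es ! i \<in> {e0, e1, e2}" "card (es ! i \<inter> ?S) = 2"
      using card2[of "es ! i"] by (auto split: if_splits)
    then show ?thesis using card_subset_eq[OF fin sub] c2 by simp
  qed
  have es_nth: "\<exists>i<length vs. es ! i = f" if "f \<in> set es" for f
    using that len by (metis in_set_conv_nth)
  have sub: "set es \<subseteq> {e0, e1, e2}" using es_nth pair by blast
  have other: "\<exists>g\<in>set es. g \<noteq> f \<and> v \<in> g" if f: "f \<in> set es" "v \<in> f" "v \<in> ?S" for f v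
  proof -
    obtain i where i: "i < length vs" "es ! i = f" using es_nth[OF f(1)] by blast
    then have "v = vs ! i \<or> v = vs ! (Suc i mod length vs)" using pair[OF i(1)] f by auto
    then show ?thesis using cycle_seq_other_edge[OF cyc i(1)] i(2) by metis
  qed
  have mem: "v \<in> f \<longleftrightarrow> v \<in> (if f = e0 then {a, b} else if f = e1 then {a, c} else if f = e2 then {b, c} else {c})"
    if "f \<in> edges H" "v \<in> ?S" for f v
    using D(14)[OF that(1)] that(2) by blast
  have ma: "a \<in> e0" "a \<in> e1" "a \<notin> e2" and mb: "b \<in> e0" "b \<notin> e1" "b \<in> e2"
    and mc: "c \<notin> e0" "c \<in> e1" "c \<in> e2"
    using mem[OF D(5)] mem[OF D(6)] mem[OF D(7)] D(8-13) by simp_all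
  have step0: "e1 \<in> set es \<and> e2 \<in> set es" if "e0 \<in> set es"
    using other[OF that, of a] other[OF that, of b] sub ma mb by blast
  have step1: "e0 \<in> set es" if "e1 \<in> set es"
    using other[OF that, of a] sub ma by blast
  have step2: "e0 \<in> set es" if "e2 \<in> set es"
    using other[OF that, of b] sub mb by blast
  obtain f where "f \<in> set es" using len by (cases es) auto
  then have "e0 \<in> set es" using sub step1 step2 by auto
  then have es: "set es = {e0, e1, e2}" using sub step0 by auto
  have "incidences vs es = (\<Union>i<length vs. (es ! i \<inter> ?S) \<times> {es ! i})"
    unfolding incidences_def using pair by (intro SUP_cong) auto
  also have "\<dots> = (\<Union>f\<in>set es. (f \<inter> ?S) \<times> {f})"
    unfolding set_conv_nth using len(1) by auto
  finally show ?thesis unfolding es .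
qed

lemma triangle_star_linear_unicyclic:
  assumes ts: "triangle_star k m H a b c e0 e1 e2" "2 \<le> k"
  shows "linear_unicyclic k m H"
proof -
  note D = triangle_starD[OF ts]
  have mem: "v \<in> f \<longleftrightarrow> v \<in> (if f = e0 then {a, b} else if f = e1 then {a, c} else if f = e2 then {b, c} else {c})"
    if "f \<in> edges H" "v \<in> {a, b, c}" for f v
    using D(14)[OF that(1)] that(2) by blast
  have ma: "a \<in> e0" "a \<in> e1" and mb: "b \<in> e0" "b \<in> e2" and mc: "c \<in> e1" "c \<in> e2"
    using mem[OF D(5)] mem[OF D(6)] mem[OF D(7)] D(8-13) by simp_all
  have "hypergraph H" unfolding hypergraph_def D(1) using D(2,3) by auto
  moreover have "uniform k H" using D(3) by (simp add: uniform_def)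
  moreover have "linear_hg H"
    unfolding linear_hg_def
  proof (intro ballI impI)
    fix e f assume ef: "e \<in> edges H" "f \<in> edges H" "e \<noteq> f"
    then have "e \<inter> f = (e \<inter> {a, b, c}) \<inter> (f \<inter> {a, b, c})" using D(15)[OF ef] by blast
    also have "card \<dots> \<le> 1"
      unfolding D(14)[OF ef(1)] D(14)[OF ef(2)] using D(11-13) ef(3) by (auto simp: Int_insert_left)
    finally show "card (e \<inter> f) \<le> 1" .
  qed
  moreover have "connected_hg H"
    unfolding connected_hg_def
  proof (intro ballI)
    let ?R = "(adj (edges H))\<^sup>*"
    have sym: "sym ?R" by (rule sym_rtrancl) (auto intro: symI)
    have to_c: "(v, c) \<in> ?R" if v: "v \<in> verts H" for v
    proof -
      from v obtain f where f: "f \<in> edges H" "v \<in> f" using D(1) by blast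
      show ?thesis
      proof (cases "f = e0")
        case True
        have "(v, a) \<in> adj (edges H)" "(a, c) \<in> adj (edges H)" using f True ma mc D(6) by blast+
        then show ?thesis by (meson converse_rtrancl_into_rtrancl r_into_rtrancl)
      next
        case False
        then have "c \<in> f" using mem[OF f(1), of c] by auto
        then show ?thesis using f by blast
      qed
    qed
    fix u v assume "u \<in> verts H" "v \<in> verts H"
    then show "(u, v) \<in> ?R" using to_c sym by (meson rtrancl_trans symD)
  qed
  moreover have cyc: "cycle_seq H [c, a, b] [e1, e0, e2]"
  proof -
    have inc: "[c, a, b] ! i \<in> [e1, e0, e2] ! i \<and> [c, a, b] ! (Suc i mod 3) \<in> [e1, e0, e2] ! i" if "i < 3" for i
    proof -
      have "i = 0 \<or> i = 1 \<or> i = 2" using that by linarith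
      then show ?thesis by (elim disjE) (simp_all add: ma mb mc)
    qed
    have "set [c, a, b] \<subseteq> verts H" using ma mb mc D(1,5-7) by auto
    moreover have "set [e1, e0, e2] \<subseteq> edges H" using D(5-7) by simp
    moreover have "distinct [c, a, b]" "distinct [e1, e0, e2]"
      using D(8-10) D(8)[symmetric] D(11-13) D(12,13)[symmetric] by simp_all
    moreover have "length [c, a, b] = 3" by simp
    ultimately show ?thesis
      unfolding cycle_seq_def using inc by simp
  qed
  moreover have "\<exists>!C. C \<in> cycles H"
  proof (rule ex1I)
    show "incidences [c, a, b] [e1, e0, e2] \<in> cycles H" unfolding cycles_def using cyc by blast
    fix C assume "C \<in> cycles H"
    then obtain vs es where C: "C = incidences vs es" "cycle_seq H vs es" unfolding cycles_def by blast
    show "C = incidences [c, a, b] [e1, e0, e2]"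
      unfolding C(1) triangle_star_incidences[OF ts C(2)] triangle_star_incidences[OF ts cyc] ..
  qed
  ultimately show ?thesis using D(4) by (simp add: linear_unicyclic_def unicyclic_def)
qed

text \<open>Edges are matched by \<open>\<phi>\<close>, with an arbitrary bijection
  \<open>\<psi>\<close> of the pendant ones. Vertices follow \<open>\<sigma>\<close> on the core
  and, in each edge \<open>f\<close>, any bijection \<open>h f\<close> of the remaining vertices,
  whose numbers agree. The pieces glue because a vertex outside the core has only one edge.\<close>

lemma triangle_star_isomorphic:
  assumes ts: "triangle_star k m H a b c e0 e1 e2" "triangle_star k m H' a' b' c' e0' e1' e2'" and "2 \<le> k"
  shows "isomorphic H H'"
proof -
  note D = triangle_starD[OF ts(1) assms(3)] and D' = triangle_starD[OF ts(2) assms(3)]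
  let ?S = "{a, b, c}" and ?S' = "{a', b', c'}"
  let ?T = "{e0, e1, e2}" and ?T' = "{e0', e1', e2'}"
  have "card (edges H - ?T) = card (edges H' - ?T')"
    using D(2,4-10) D'(2,4-10) by (simp add: card_Diff_subset)
  then obtain \<psi> where \<psi>: "bij_betw \<psi> (edges H - ?T) (edges H' - ?T')"
    using finite_same_card_bij[of "edges H - ?T" "edges H' - ?T'"] D(2) D'(2) by auto
  define \<phi> where "\<phi> = (\<lambda>f. if f = e0 then e0' else if f = e1 then e1' else if f = e2 then e2' else \<psi> f)"
  have "bij_betw \<phi> ?T ?T'"
    using D(8-10) D'(8-10) by (auto simp: bij_betw_def \<phi>_def)
  moreover have "bij_betw \<phi> (edges H - ?T) (edges H' - ?T')"
    using \<psi> by (rule bij_betw_cong[THEN iffD1, rotated]) (auto simp: \<phi>_def)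
  ultimately have "bij_betw \<phi> (?T \<union> (edges H - ?T)) (?T' \<union> (edges H' - ?T'))"
    by (rule bij_betw_combine) blast
  moreover have "?T \<union> (edges H - ?T) = edges H" "?T' \<union> (edges H' - ?T') = edges H'"
    using D(5-7) D'(5-7) by blast+
  ultimately have \<phi>: "bij_betw \<phi> (edges H) (edges H')" by simp
  define \<sigma> where "\<sigma> = (\<lambda>v. if v = a then a' else if v = b then b' else c')"
  have \<sigma>inj: "inj_on \<sigma> ?S" using D(11-13) D'(11-13) by (auto simp: inj_on_def \<sigma>_def)
  have \<phi>E: "\<phi> f \<in> edges H'" if "f \<in> edges H" for f using \<phi> that by (auto simp: bij_betw_def)
  have \<sigma>im: "\<phi> f \<inter> ?S' = \<sigma> ` (f \<inter> ?S)" if f: "f \<in> edges H" for f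
  proof -
    note simps = D(8-10) D(8-10)[symmetric] D'(8-10) D'(8-10)[symmetric] \<phi>_def \<sigma>_def
      D(11-13)[symmetric]
    consider "f = e0" | "f = e1" | "f = e2" | "f \<notin> ?T" by blast
    then show ?thesis
    proof cases
      case 1
      then show ?thesis using D(14)[OF D(5)] D'(14)[OF D'(5)] by (simp add: simps insert_commute)
    next
      case 2
      then show ?thesis using D(14)[OF D(6)] D'(14)[OF D'(6)] by (simp add: simps insert_commute)
    next
      case 3
      then show ?thesis using D(14)[OF D(7)] D'(14)[OF D'(7)] by (simp add: simps insert_commute)
    next
      case 4
      then have "f \<in> edges H - ?T" using f by simp
      then have \<psi>f: "\<psi> f \<in> edges H' - ?T'" by (rule bij_betw_apply[OF \<psi>])
      have "f \<inter> ?S = {c}" using D(14)[OF f] 4 by simp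
      moreover have "\<psi> f \<inter> ?S' = {c'}" using D'(14)[of "\<psi> f"] \<psi>f by simp
      moreover have "\<phi> f = \<psi> f" "\<sigma> c = c'" using 4 D(12,13) by (simp_all add: \<phi>_def \<sigma>_def)
      ultimately show ?thesis by simp
    qed
  qed
  have ex_h: "\<exists>h. bij_betw h (f - ?S) (\<phi> f - ?S')" if f: "f \<in> edges H" for f
  proof -
    have "inj_on \<sigma> (f \<inter> ?S)" by (rule inj_on_subset[OF \<sigma>inj]) simp
    then have c: "card (\<phi> f \<inter> ?S') = card (f \<inter> ?S)" by (simp only: \<sigma>im[OF f] card_image)
    have fin: "finite f" "finite (\<phi> f)" and k: "card f = k" "card (\<phi> f) = k"
      using D(3)[OF f] D'(3)[OF \<phi>E[OF f]] by simp_all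
    have "card (f - ?S) = card f - card (f \<inter> ?S)" using fin by (intro card_Diff_subset_Int) simp
    moreover have "card (\<phi> f - ?S') = card (\<phi> f) - card (\<phi> f \<inter> ?S')"
      using fin by (intro card_Diff_subset_Int) simp
    ultimately have "card (f - ?S) = card (\<phi> f - ?S')" by (simp only: c k)
    moreover have "finite (f - ?S)" "finite (\<phi> f - ?S')" using fin by simp_all
    ultimately show ?thesis by (intro finite_same_card_bij)
  qed
  define h where "h f = (SOME h. bij_betw h (f - ?S) (\<phi> f - ?S'))" for f
  have h: "bij_betw (h f) (f - ?S) (\<phi> f - ?S')" if "f \<in> edges H" for f
    unfolding h_def using ex_h[OF that] by (rule someI_ex)
  define G where "G = (\<lambda>v. if v \<in> ?S then \<sigma> v else h (THE f. f \<in> edges H \<and> v \<in> f) v)"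
  have GS: "G v = \<sigma> v" if "v \<in> ?S" for v using that by (simp add: G_def)
  have Gh: "G v = h f v" if "f \<in> edges H" "v \<in> f" "v \<notin> ?S" for f v
  proof -
    have "(THE f. f \<in> edges H \<and> v \<in> f) = f"
      using that D(15)[of _ f v] by (intro the_equality) metis+
    then show ?thesis using that(3) by (simp add: G_def)
  qed
  have Gim: "G ` f = \<phi> f" if f: "f \<in> edges H" for f
  proof -
    have "G ` f = G ` (f \<inter> ?S) \<union> G ` (f - ?S)" by blast
    also have "G ` (f \<inter> ?S) = \<sigma> ` (f \<inter> ?S)" using GS by (intro image_cong) auto
    also have "\<dots> = \<phi> f \<inter> ?S'" using \<sigma>im[OF f] ..
    also have "G ` (f - ?S) = h f ` (f - ?S)" using Gh[OF f] by (intro image_cong) auto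
    also have "\<dots> = \<phi> f - ?S'" using h[OF f] by (auto simp: bij_betw_def)
    finally show ?thesis by blast
  qed
  have G_notin: "G v \<in> \<phi> f - ?S'" if "f \<in> edges H" "v \<in> f" "v \<notin> ?S" for f v
    using Gh[OF that] h[OF that(1)] that by (auto simp: bij_betw_def)
  have G_in: "G v \<in> ?S'" if "v \<in> ?S" for v using GS[OF that] by (auto simp: \<sigma>_def)
  have "inj_on G (\<Union>(edges H))"
  proof (rule inj_onI)
    fix v w assume "v \<in> \<Union>(edges H)" "w \<in> \<Union>(edges H)" and eq: "G v = G w"
    then obtain f g where fg: "f \<in> edges H" "v \<in> f" "g \<in> edges H" "w \<in> g" by blast
    show "v = w"
    proof (cases "v \<in> ?S")
      case True
      then have w: "w \<in> ?S" using G_in[OF True] G_notin[OF fg(3,4)] eq by auto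
      show ?thesis using inj_onD[OF \<sigma>inj _ True w] eq GS[OF True] GS[OF w] by simp
    next
      case False
      then have w: "w \<notin> ?S" using G_in[of w] G_notin[OF fg(1,2)] eq by auto
      \<comment> \<open>The common image lies outside the core, hence in one edge only, which forces
        the two edges to agree.\<close>
      have "G v \<in> \<phi> f" "G v \<in> \<phi> g" "G v \<notin> ?S'"
        using G_notin[OF fg(1,2) False] G_notin[OF fg(3,4) w] eq by auto
      then have "\<phi> f = \<phi> g" using D'(15)[OF \<phi>E[OF fg(1)] \<phi>E[OF fg(3)]] by blast
      then have "f = g" using \<phi> fg by (auto simp: bij_betw_def inj_on_def)
      then have "h f v = h f w" "w \<in> f" using Gh[OF fg(1,2) False] Gh[OF fg(3,4) w] eq fg(4) by auto
      then show ?thesis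
        using inj_onD[OF bij_betw_imp_inj_on[OF h[OF fg(1)]], of v w] fg(2) False w by simp
    qed
  qed
  moreover have im: "(\<lambda>e. G ` e) ` edges H = edges H'"
    using Gim \<phi> by (simp add: bij_betw_def)
  moreover have "G ` \<Union>(edges H) = \<Union>(edges H')" unfolding im[symmetric] by (rule image_Union)
  ultimately show ?thesis
    unfolding isomorphic_def D(1) D'(1) bij_betw_def by blast
qed

section \<open>The concrete hypergraph as a triangle star\<close>

lemma edges_cycle_graph_3:
  assumes "distinct [i, j, l]" "i < 3" "j < 3" "l < 3"
  shows "verts (cycle_graph 3) = {i, j, l}" "edges (cycle_graph 3) = {{i, j}, {j, l}, {i, l}}"
proof -
  have three: "{..<3::nat} = {0, 1, 2}" by auto
  have "i = 0 \<or> i = 1 \<or> i = 2" "j = 0 \<or> j = 1 \<or> j = 2" "l = 0 \<or> l = 1 \<or> l = 2" using assms by linarith+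
  then have "(i, j, l) \<in> {(0,1,2), (0,2,1), (1,0,2), (1,2,0), (2,0,1), (2,1,0)}"
    using assms(1) by auto
  then show "verts (cycle_graph 3) = {i, j, l}" "edges (cycle_graph 3) = {{i, j}, {j, l}, {i, l}}"
    by (auto simp: cycle_graph_def three insert_commute)
qed

text \<open>A vertex inserted into an edge lies in the enlargement of that edge alone, hence is
  cored.\<close>

lemma not_cored_hypercycle:
  assumes "v \<in> verts (hypercycle k 3)" "\<not> cored (hypercycle k 3) v"
  obtains i where "i < 3" "v = Inl i"
proof (cases v)
  case (Inl i)
  then show thesis using that assms(1) by (auto simp: hypercycle_def insert_cored_def cycle_graph_def)
next
  case (Inr p)
  let ?P = "\<lambda>e. Inl ` e \<union> Inr ` ({e} \<times> {..<k - 2}) :: (nat + nat set \<times> nat) set"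
  obtain e j where p: "p = (e, j)" by (cases p)
  have ej: "e \<in> edges (cycle_graph 3)" "j < k - 2"
    using assms(1) Inr p by (auto simp: hypercycle_def insert_cored_def)
  have "edges (hypercycle k 3) = ?P ` edges (cycle_graph 3)" by (simp add: hypercycle_def insert_cored_def)
  then have "{f \<in> edges (hypercycle k 3). v \<in> f} = {?P e}" using ej Inr p by auto
  then have "cored (hypercycle k 3) v" using assms(1) by (simp add: cored_def degree_def)
  with assms(2) show thesis by simp
qed

lemma triangle_star_add_pendants:
  assumes k: "2 \<le> k" "3 \<le> m" and "i < 3"
  shows "\<exists>a b e0 e1 e2. triangle_star k m (add_pendants k (m - 3) (Inl i) (hypercycle k 3)) a b (Inl (Inl i)) e0 e1 e2"
proof -
  let ?X = "add_pendants k (m - 3) (Inl i) (hypercycle k 3)"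
  obtain j l where ijl: "distinct [i, j, l]" "j < 3" "l < 3"
  proof -
    have "i = 0 \<or> i = 1 \<or> i = 2" using assms(3) by linarith
    then show thesis using that[of 1 2] that[of 0 2] that[of 0 1] by auto
  qed
  note cg = edges_cycle_graph_3[OF ijl(1) assms(3) ijl(2,3)]
  \<comment> \<open>\<open>P e\<close> is the enlarged triangle edge and \<open>Q s\<close> a
    pendant edge. For \<open>k = 2\<close> nothing is inserted, so the sets \<open>P e\<close> are
    told apart by their triangle vertices.\<close>
  define P :: "nat set \<Rightarrow> ((nat + nat set \<times> nat) + nat \<times> nat) set" where
    "P e = Inl ` (Inl ` e \<union> Inr ` ({e} \<times> {..<k - 2}))" for e
  define Q :: "nat \<Rightarrow> ((nat + nat set \<times> nat) + nat \<times> nat) set" where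
    "Q s = insert (Inl (Inl i)) (Inr ` ({s} \<times> {..<k - 1}))" for s
  let ?e0 = "P {j, l}" and ?e1 = "P {i, j}" and ?e2 = "P {i, l}"
  have E: "edges ?X = {?e1, ?e0, ?e2} \<union> Q ` {..<m - 3}"
    by (auto simp: add_pendants_def hypercycle_def insert_cored_def cg P_def Q_def)
  have V: "verts ?X = \<Union>(edges ?X)"
    unfolding E by (auto simp: add_pendants_def hypercycle_def insert_cored_def cg P_def Q_def)
  have ne: "i \<noteq> j" "i \<noteq> l" "j \<noteq> l" using ijl(1) by auto
  have inP: "Inl (Inl x) \<in> P e \<longleftrightarrow> x \<in> e" for x e by (auto simp: P_def)
  have inQ: "Inl (Inl x) \<in> Q s \<longleftrightarrow> x = i" for x s by (auto simp: Q_def)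
  have PP: "P e \<inter> P f = Inl ` Inl ` (e \<inter> f)" if "e \<noteq> f" for e f using that by (auto simp: P_def)
  have PQ: "P e \<inter> Q s = (if i \<in> e then {Inl (Inl i)} else {})" for e s by (auto simp: P_def Q_def)
  have QQ: "Q s \<inter> Q t = {Inl (Inl i)}" if "Q s \<noteq> Q t" for s t
    using that by (cases "s = t") (auto simp: Q_def)
  have neP: "?e0 \<noteq> ?e1" "?e0 \<noteq> ?e2" "?e1 \<noteq> ?e2"
    using inP ne by (metis insertCI insertE singletonD)+
  have cardP: "card (P e) = k" if "card e = 2" for e
  proof -
    have fin: "finite e" using that by (simp add: card_ge_0_finite)
    have "card (P e) = card (Inl ` e \<union> Inr ` ({e} \<times> {..<k - 2}) :: (nat + nat set \<times> nat) set)"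
      unfolding P_def by (rule card_image) simp
    also have "\<dots> = card (Inl ` e :: (nat + nat set \<times> nat) set) + card (Inr ` ({e} \<times> {..<k - 2}) :: (nat + nat set \<times> nat) set)"
      using fin by (intro card_Un_disjoint) auto
    also have "\<dots> = 2 + (k - 2)" using that by (simp add: card_image)
    finally show ?thesis using k by simp
  qed
  have cardQ: "card (Q s) = k" for s
  proof -
    have "card (Q s) = Suc (card (Inr ` ({s} \<times> {..<k - 1}) :: ((nat + nat set \<times> nat) + nat \<times> nat) set))"
      unfolding Q_def by (rule card_insert_disjoint) auto
    also have "\<dots> = Suc (k - 1)" by (simp add: card_image)
    finally show ?thesis using k by simp
  qed
  have "inj_on Q {..<m - 3}"
  proof (rule inj_onI)
    fix s t assume "Q s = Q t"
    moreover have "Inr (s, 0) \<in> Q s" using k by (auto simp: Q_def)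
    ultimately show "s = t" by (auto simp: Q_def)
  qed
  then have cardQs: "card (Q ` {..<m - 3}) = m - 3" by (simp add: card_image)
  have nePQ: "P e \<noteq> Q s" for e s
  proof -
    have "Inr (s, 0) \<in> Q s" "Inr (s, 0) \<notin> P e" using k by (auto simp: Q_def P_def)
    then show ?thesis by metis
  qed
  have "card (edges ?X) = card {?e1, ?e0, ?e2} + card (Q ` {..<m - 3})"
    unfolding E using nePQ by (intro card_Un_disjoint) auto
  also have "card {?e1, ?e0, ?e2} = 3" using neP by simp
  finally have cardE: "card (edges ?X) = m" using cardQs k by simp
  have uni: "uniform k ?X" unfolding uniform_def E using cardP cardQ ne by auto
  have rest: "edges ?X - {?e0} = {?e1, ?e2} \<union> Q ` {..<m - 3}"
    unfolding E using neP nePQ by auto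
  have rest': "edges ?X - {?e0, ?e1, ?e2} = Q ` {..<m - 3}"
    unfolding E using nePQ by auto
  have i12: "?e1 \<inter> ?e2 = {Inl (Inl i)}" "?e0 \<inter> ?e1 = {Inl (Inl j)}" "?e0 \<inter> ?e2 = {Inl (Inl l)}"
    using ne by (subst PP; auto simp: doubleton_eq_iff)+
  have "triangle_star k m ?X (Inl (Inl j)) (Inl (Inl l)) (Inl (Inl i)) ?e0 ?e1 ?e2"
    unfolding triangle_star_def
  proof (intro conjI)
    show "\<forall>f\<in>edges ?X - {?e0}. Inl (Inl i) \<in> f" unfolding rest using inP inQ by auto
    show "\<forall>f\<in>edges ?X - {?e0}. \<forall>g\<in>edges ?X - {?e0}. f \<noteq> g \<longrightarrow> f \<inter> g = {Inl (Inl i)}"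
    proof (intro ballI impI)
      fix f g assume "f \<in> edges ?X - {?e0}" "g \<in> edges ?X - {?e0}" and fg: "f \<noteq> g"
      then have "f = ?e1 \<or> f = ?e2 \<or> (\<exists>s. f = Q s)" "g = ?e1 \<or> g = ?e2 \<or> (\<exists>s. g = Q s)"
        unfolding rest by auto
      moreover have "?e1 \<inter> Q s = {Inl (Inl i)}" "?e2 \<inter> Q s = {Inl (Inl i)}" for s
        unfolding PQ by auto
      ultimately show "f \<inter> g = {Inl (Inl i)}" using i12(1) fg
        by (elim disjE exE) (simp_all add: Int_commute QQ)
    qed
    show "\<forall>f\<in>edges ?X - {?e0, ?e1, ?e2}. ?e0 \<inter> f = {}" unfolding rest' using PQ ne by auto
    show "Inl (Inl i) \<notin> ?e0" using inP ne by simp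
    show "finite (edges ?X)" unfolding E by simp
    show "{?e0, ?e1, ?e2} \<subseteq> edges ?X" unfolding E by simp
  qed (fact V uni cardE neP i12)+
  then show ?thesis by blast
qed

theorem theorem5p2:
  fixes k m :: nat and \<alpha> :: real and v :: "nat + nat set \<times> nat"
  assumes "2 \<le> k" and "3 \<le> m" and "0 < \<alpha>" and "\<alpha> < 1"
    and "v \<in> verts (hypercycle k 3)" and "\<not> cored (hypercycle k 3) v"
  shows "linear_unicyclic k m (add_pendants k (m - 3) v (hypercycle k 3)) \<and>
    (\<forall>H :: 'a hypergraph. linear_unicyclic k m H \<and>
        \<not> isomorphic H (add_pendants k (m - 3) v (hypercycle k 3)) \<longrightarrow>
      S_less k \<alpha> H (add_pendants k (m - 3) v (hypercycle k 3)))"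
proof -
  let ?X = "add_pendants k (m - 3) v (hypercycle k 3)"
  obtain i where i: "i < 3" "v = Inl i" using not_cored_hypercycle[OF assms(5,6)] .
  obtain a b c e0 e1 e2 where ts: "triangle_star k m ?X a b c e0 e1 e2"
    using triangle_star_add_pendants[OF assms(1,2) i(1)] unfolding i(2) by metis
  have X: "linear_unicyclic k m ?X" using triangle_star_linear_unicyclic[OF ts assms(1)] .
  note XD = linear_unicyclicD[OF X assms(1)]
  have "S_less k \<alpha> H ?X" if H: "linear_unicyclic k m H" "\<not> isomorphic H ?X" for H :: "'a hypergraph"
  proof -
    note HD = linear_unicyclicD[OF H(1) assms(1)]
    let ?n = "m * (k - 1)"
    \<comment> \<open>Otherwise \<open>H\<close> would be a triangle star with centre
      \<open>u\<close>, hence isomorphic to \<open>?X\<close>.\<close>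
    have small: "degree H u < m - 1" if u: "u \<in> verts H" for u
    proof (rule ccontr)
      assume "\<not> ?thesis"
      then obtain a' b' e0' e1' e2' where "triangle_star k m H a' b' u e0' e1' e2'"
        using large_degree_triangle_star[OF H(1) assms(1,2) u] by auto
      then show False using triangle_star_isomorphic[OF _ ts assms(1)] H(2) by metis
    qed
    have less: "(\<Sum>v\<in>verts H. (degree H v)\<^sup>2) < (\<Sum>v\<in>verts ?X. (degree ?X v)\<^sup>2)"
      using sum_degree_squares_less[OF H(1) X assms(1,2) small triangle_star_degree[OF ts assms(1)]] .
    have pos: "0 < (k - 1) ^ (?n - 1)" using assms(1) by simp
    \<comment> \<open>The order only admits indices below the number of eigenvalues, so the index 2
      requires at least three of them.\<close>
    have "3 * 1 \<le> ?n" using assms(1,2) by (intro mult_le_mono) auto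
    moreover have "?n * 1 \<le> ?n * (k - 1) ^ (?n - 1)" using pos by (intro mult_le_mono) auto
    ultimately have "3 \<le> ?n * (k - 1) ^ (?n - 1)" by linarith
    then have range: "2 \<in> {1..?n * (k - 1) ^ (?n - 1) - 1}" by simp
    have "Tr k (verts H) (A_alpha k \<alpha> H) 0 = Tr k (verts ?X) (A_alpha k \<alpha> ?X) 0"
      by (simp add: Tr_def HD(9) XD(9))
    moreover have "Tr k (verts H) (A_alpha k \<alpha> H) 1 = Tr k (verts ?X) (A_alpha k \<alpha> ?X) 1"
      unfolding Tr_1[OF HD(1,2) assms(1)] Tr_1[OF XD(1,2) assms(1)]
        sum_degree[OF HD(1,2)] sum_degree[OF XD(1,2)] HD(5,9) XD(5,9) ..
    moreover have "t = 0 \<or> t = 1" if "t < 2" for t :: nat using that by linarith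
    ultimately have eq: "Tr k (verts H) (A_alpha k \<alpha> H) t = Tr k (verts ?X) (A_alpha k \<alpha> ?X) t"
      if "t < 2" for t using that by metis
    \<comment> \<open>Here \<alpha> > 0 gives strictness; the summand for \<open>k = 2\<close> is
      the same on both sides and cancels below.\<close>
    have "\<alpha>\<^sup>2 * real (\<Sum>v\<in>verts H. (degree H v)\<^sup>2) < \<alpha>\<^sup>2 * real (\<Sum>v\<in>verts ?X. (degree ?X v)\<^sup>2)"
      using less assms(3) by (intro mult_strict_left_mono) (simp_all only: of_nat_less_iff zero_less_power)
    then have "Tr k (verts H) (A_alpha k \<alpha> H) 2 < Tr k (verts ?X) (A_alpha k \<alpha> ?X) 2"
      unfolding Tr_2[OF HD(1,2) assms(1)] Tr_2[OF XD(1,2) assms(1)] HD(5,9) XD(5,9)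
      using pos by (intro mult_strict_left_mono) (simp_all only: of_nat_0_less_iff add_less_cancel_right)
    then show ?thesis
      unfolding S_less_def HD(9) XD(9) using eq range by blast
  qed
  then show ?thesis using X by blast
qed

end
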